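(* Let $\Sigma$ be a finite alphabet with $|\Sigma|\ge 2$ and let $d\ge 2$. There exist a uniquely ergodic shift of finite type $X\subseteq\Sigma^{\mathbb{Z}^d}$ and two cylinder sets $C,C'\subseteq\Sigma^{\mathbb{Z}^d}$ such that the unique invariant probability measure $\mu$ on $X$ satisfies $\mu(C')>0$ and $\mu(C)/\mu(C')\notin\mathbb{Q}$.
   Context: $\Omega=\Sigma^{\mathbb{Z}^d}$ with the product topology and the shift action $(\Theta^u x)_v=x_{u+v}$ of $\mathbb{Z}^d$. $\Lambda_n=\{-n,\ldots,n\}^d$, $\Omega_n=\Sigma^{\Lambda_n}$. A shift of finite type (SFT) is a set of the form $SFT(L)=\{x\in\Omega : (\Theta^u x)|_{\Lambda_n}\notin L \text{ for every } u\in\mathbb{Z}^d\}$ for some $n$ and some $L\subseteq\Omega_n$. It is uniquely ergodic if it supports exactly one $\Theta$-invariant Borel probability measure. A cylinder set is a set $[a]=\{x\in\Omega : x|_E=a\}$ with $E\subseteq\mathbb{Z}^d$ finite and $a\in\Sigma^E$. *)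

theory Defs
  imports "HOL-Probability.Probability"
begin

text \<open>
  \<open>\<int>\<^sup>d\<close> is \<^typ>\<open>int ^ 'd\<close> with \<open>d = CARD('d)\<close>, the alphabet is a finite type \<^typ>\<open>'a\<close>.
  Patterns on \<open>E\<close> are the extensional functions \<open>E \<rightarrow>\<^sub>E UNIV\<close>, so that the restriction
  of a configuration to \<open>E\<close> is the library's \<^const>\<open>restrict\<close>.
\<close>

type_synonym ('d, 'a) configuration = "int ^ 'd \<Rightarrow> 'a"

definition shift :: "int ^ 'd \<Rightarrow> ('d::finite, 'a) configuration \<Rightarrow> ('d, 'a) configuration" where
  "shift u x = (\<lambda>v. x (u + v))"

definition box :: "nat \<Rightarrow> (int ^ 'd) set" where
  "box n = {v. \<forall>i. v $ i \<in> {- int n..int n}}"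

definition SFT :: "nat \<Rightarrow> (int ^ 'd \<Rightarrow> 'a) set \<Rightarrow> ('d::finite, 'a) configuration set" where
  "SFT n L = {x. \<forall>u. restrict (shift u x) (box n) \<notin> L}"

definition shift_of_finite_type :: "('d::finite, 'a) configuration set \<Rightarrow> bool" where
  "shift_of_finite_type X \<longleftrightarrow> (\<exists>n L. L \<subseteq> (box n \<rightarrow>\<^sub>E UNIV) \<and> X = SFT n L)"

definition cylinder :: "(int ^ 'd) set \<Rightarrow> (int ^ 'd \<Rightarrow> 'a) \<Rightarrow> ('d::finite, 'a) configuration set" where
  "cylinder E a = {x. restrict x E = a}"

definition cylinder_set :: "('d::finite, 'a) configuration set \<Rightarrow> bool" where
  "cylinder_set C \<longleftrightarrow> (\<exists>E a. finite E \<and> a \<in> (E \<rightarrow>\<^sub>E UNIV) \<and> C = cylinder E a)"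

definition configuration_topology :: "('d::finite, 'a) configuration topology" where
  "configuration_topology = product_topology (\<lambda>_. discrete_topology UNIV) UNIV"

definition configuration_borel :: "('d::finite, 'a) configuration measure" where
  "configuration_borel = sigma UNIV {U. openin configuration_topology U}"

text \<open>
  Shift-invariant Borel probability measures supported by \<open>X\<close>, as measures on the full
  configuration space giving mass 1 to \<open>X\<close>. Since \<^const>\<open>emeasure\<close> vanishes outside the
  sigma-algebra, the last condition includes that \<open>X\<close> is Borel.
\<close>

definition invariant_measures :: "('d::finite, 'a) configuration set \<Rightarrow> ('d, 'a) configuration measure set" where
  "invariant_measures X = {\<mu>. prob_space \<mu> \<and> sets \<mu> = sets configuration_borel \<and>
     (\<forall>u. \<forall>A\<in>sets \<mu>. emeasure \<mu> (shift u -` A) = emeasure \<mu> A) \<and> emeasure \<mu> X = 1}"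

definition uniquely_ergodic :: "('d::finite, 'a) configuration set \<Rightarrow> bool" where
  "uniquely_ergodic X \<longleftrightarrow> (\<exists>!\<mu>. \<mu> \<in> invariant_measures X)"

end

theory Submission
  imports Defs
begin

text \<open>
  Let \<open>gold = (\<surd>5 - 1) / 2\<close>. Consider four sequences \<open>A, B, C, K\<close> of integers indexed by \<open>\<int>\<close>, with
  increments in \<open>{0, 1}\<close>, such that for all \<open>m\<close> and \<open>k\<close> the numbers
  \<open>C (m + k) - A m - B k\<close>, \<open>K (k - m - A m) - B k + m\<close> and \<open>C (m + k) - A m - m - K (k - m - A m)\<close>
  lie in \<open>{0, 1}\<close>. Writing the increments and the last two numbers at the site \<open>(m, k)\<close> turns this into a
  local condition on an array over \<open>\<int>\<^sup>2\<close>, because an increment of \<open>K\<close> can be transported along the discrete line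
  on which \<open>k - m - A m\<close> is constant. The first condition makes \<open>A\<close>, \<open>B\<close>, \<open>C\<close> nearly additive with a common
  slope, the second one forces the slope \<open>\<alpha>\<close> to satisfy \<open>\<alpha> + \<alpha>\<^sup>2 = 1\<close>. In the first condition \<open>m\<close> and \<open>k\<close>
  are independent, so the suprema of \<open>A m - \<alpha> m\<close> and \<open>B k - \<alpha> k\<close> are nearly attained simultaneously; hence both
  oscillate by at most 1, and \<open>A m = \<lfloor>\<alpha> m + \<rho>\<rfloor>\<close>, \<open>B k = \<lfloor>\<alpha> k + \<sigma>\<rfloor>\<close> with phases \<open>\<rho>\<close>, \<open>\<sigma>\<close>. For almost all phases \<open>C\<close>
  and \<open>K\<close> are determined as well. The shifts act on \<open>(\<rho>, \<sigma>)\<close> as irrational rotations of the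
  torus, for which Lebesgue measure is the only invariant measure, so that the array system is uniquely ergodic.
  A self-synchronizing block code brings the array into the given alphabet, and the frequency of
  \<open>A (m + 1) - A m = 1\<close> relative to that of the block beginnings is \<open>gold\<close>.
\<close>


section \<open>Integer sequences\<close>

definition gold :: real where
  "gold = (sqrt 5 - 1) / 2"

lemma gold_square: "gold * gold = 1 - gold"
  by (simp add: gold_def field_simps)

lemma gold_pos: "0 < gold" and gold_less_1: "gold < 1"
proof -
  have "1 < sqrt (5::real)" "sqrt (5::real) < 3"
    by (auto intro: real_less_rsqrt real_less_lsqrt)
  then show "0 < gold" "gold < 1" by (simp_all add: gold_def)
qed

lemma gold_irrational: "gold \<notin> \<rat>"
proof
  assume "gold \<in> \<rat>"
  then have "2 * gold + 1 \<in> \<rat>" by simp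
  moreover have "2 * gold + 1 = sqrt 5" by (simp add: gold_def field_simps)
  ultimately have "sqrt (5::real) \<in> \<rat>" by simp
  then obtain m n :: nat where n: "n \<noteq> 0" and "\<bar>sqrt 5\<bar> = real m / real n" and cop: "coprime m n"
    by (rule Rats_abs_nat_div_natE)
  then have "real m = sqrt 5 * real n" by simp
  then have "real (m\<^sup>2) = real (5 * n\<^sup>2)" by (simp add: power_mult_distrib)
  then have eq: "m\<^sup>2 = 5 * n\<^sup>2" by linarith
  have prime: "prime (5::nat)" by simp
  have "5 dvd m\<^sup>2" by (simp add: eq)
  then have m: "5 dvd m" using prime_dvd_power[OF prime] by blast
  then obtain k where "m = 5 * k" by blast
  with eq have "n\<^sup>2 = 5 * k\<^sup>2" by (simp add: power_mult_distrib)
  then have "5 dvd n\<^sup>2" by simp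
  then have "5 dvd n" using prime_dvd_power[OF prime] by blast
  with m cop have "5 dvd (1::nat)" by (metis coprime_common_divisor dvd_1_iff_1)
  then show False by simp
qed

text \<open>Kronecker approximation of the midpoint of the interval, moved by \<open>- x\<close>,
  with error below half its length.\<close>

lemma gold_orbit_dense:
  assumes "p < q"
  shows "\<exists>m n::int. p < x + of_int m * gold + of_int n \<and> x + of_int m * gold + of_int n < q"
proof -
  obtain h k where "k > 0" and hk: "\<bar>of_int k * gold - of_int h - ((p + q) / 2 - x)\<bar> < (q - p) / 2"
    using sequence_of_fractional_parts_is_dense[OF gold_irrational] assms half_gt_zero[of "q - p"] by (metis diff_gt_0_iff_gt)
  then have "p < x + of_int k * gold + of_int (- h) \<and> x + of_int k * gold + of_int (- h) < q"
    unfolding abs_less_iff by (simp add: field_simps)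
  then show ?thesis by blast
qed

text \<open>The deviation \<open>\<Delta> m = A m - gold * m\<close> satisfies \<open>\<Delta> (A m) = - (1 + gold) * \<Delta> m + O(1)\<close>, while
  \<open>\<bar>A m\<bar> \<le> \<bar>m\<bar>\<close>; so its maximum over \<open>{-N..N}\<close> is bounded independently of \<open>N\<close>.\<close>

lemma gold_multiple_bounded:
  fixes A :: "int \<Rightarrow> int"
  assumes "A 0 = 0" and inc: "\<And>m. A (m + 1) - A m \<in> {0, 1}"
    and add: "\<And>m n. \<bar>A (m + n) - A m - A n\<bar> \<le> c"
    and inv: "\<And>m. \<bar>A (m + A m) - m\<bar> \<le> c"
  shows "\<exists>D. \<forall>m. \<bar>of_int (A m) - gold * of_int m\<bar> \<le> D"
proof -
  define \<Delta> where "\<Delta> m = of_int (A m) - gold * of_int m" for m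
  have up: "0 \<le> A (m + int k) - A m \<and> A (m + int k) - A m \<le> int k" for m k
  proof (induction k)
    case (Suc k)
    then show ?case using inc[of "m + int k"] by (auto simp: algebra_simps)
  qed simp
  have A_le: "\<bar>A m\<bar> \<le> \<bar>m\<bar>" for m
    using up[of 0 "nat m"] up[of m "nat (- m)"] \<open>A 0 = 0\<close> by (cases "m \<ge> 0") auto
  have step: "\<bar>\<Delta> (A m) + (1 + gold) * \<Delta> m\<bar> \<le> 2 * of_int c" for m
  proof -
    \<comment> \<open>The coefficient of \<open>m\<close> is \<open>gold + gold * gold = 1\<close>,
      so the sum collapses to an integer that \<open>add\<close> and \<open>inv\<close>
      bound.\<close>
    have "\<Delta> (A m) + (1 + gold) * \<Delta> m = of_int (A (A m) + A m) - (gold + gold * gold) * of_int m"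
      by (simp add: \<Delta>_def algebra_simps)
    also have "\<dots> = of_int (A (A m) + A m - m)"
      by (simp add: gold_square)
    also have "\<bar>\<dots>\<bar> \<le> 2 * of_int c"
    proof -
      have "\<bar>A (A m) + A m - m\<bar> \<le> 2 * c" using add[of m "A m"] inv[of m] by linarith
      then show ?thesis by linarith
    qed
    finally show ?thesis .
  qed
  have "\<bar>\<Delta> m\<bar> \<le> 2 * of_int c / gold" for m
  proof -
    define S where "S = {n. \<bar>n\<bar> \<le> \<bar>m\<bar>}"
    have "S = {-\<bar>m\<bar>..\<bar>m\<bar>}" by (auto simp: S_def)
    then have fin: "finite ((\<lambda>n. \<bar>\<Delta> n\<bar>) ` S)" by simp
    define M where "M = Max ((\<lambda>n. \<bar>\<Delta> n\<bar>) ` S)"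
    have le: "\<bar>\<Delta> n\<bar> \<le> M" if "n \<in> S" for n
      unfolding M_def using fin that by (intro Max_ge) auto
    have "M \<in> (\<lambda>n. \<bar>\<Delta> n\<bar>) ` S"
      unfolding M_def using fin by (intro Max_in) (auto simp: S_def)
    then obtain n where n: "n \<in> S" "M = \<bar>\<Delta> n\<bar>" by auto
    have "\<bar>\<Delta> (A n)\<bar> \<le> M" using A_le[of n] n(1) by (intro le) (simp add: S_def)
    moreover have "\<bar>(1 + gold) * \<Delta> n\<bar> = (1 + gold) * M"
      using gold_pos n(2) by (simp add: abs_mult)
    ultimately have "(1 + gold) * M \<le> M + 2 * of_int c"
      using step[of n] by linarith
    then have "M \<le> 2 * of_int c / gold"
      using gold_pos by (simp add: field_simps)
    then show ?thesis using le[of m] by (simp add: S_def)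
  qed
  then show ?thesis unfolding \<Delta>_def by blast
qed

section \<open>Phases of nearly additive sequences\<close>

lemma additive_triple_phase:
  fixes A B C :: "int \<Rightarrow> int"
  assumes R1: "\<And>m k. C (m + k) - A m - B k \<in> {0, 1}"
    and bA: "\<And>m. \<bar>of_int (A m) - t * of_int m\<bar> \<le> D"
    and bB: "\<And>m. \<bar>of_int (B m) - t * of_int m\<bar> \<le> D"
  defines "\<rho> \<equiv> (SUP m. of_int (A m) - t * of_int m :: real)"
  shows "t * of_int m + \<rho> - 1 \<le> of_int (A m) \<and> of_int (A m) \<le> t * of_int m + \<rho>"
proof -
  define a where "a m = of_int (A m) - t * of_int m" for m
  define b where "b m = of_int (B m) - t * of_int m" for m
  have bdd: "bdd_above (range a)" "bdd_above (range b)"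
    using bA bB by (auto intro!: bdd_aboveI2[where M=D] simp: a_def b_def abs_le_iff)
  have le: "a m \<le> \<rho>" for m
    unfolding \<rho>_def using cSUP_upper[OF _ bdd(1)] by (simp add: a_def)
  define \<sigma> where "\<sigma> = (SUP m. b m)"
  have leb: "b m \<le> \<sigma>" for m
    unfolding \<sigma>_def using cSUP_upper[OF _ bdd(2)] by simp
  have "\<rho> - 1 \<le> a m"
  proof (rule ccontr)
    assume "\<not> ?thesis"
    then have pos: "0 < \<rho> - 1 - a m" by simp
    \<comment> \<open>Two suprema are approximated below, each within half of the assumed
      gap.\<close>
    define \<epsilon> where "\<epsilon> = (\<rho> - 1 - a m) / 2"
    obtain m' where m': "\<rho> - \<epsilon> < a m'"
      using less_cSUP_iff[OF _ bdd(1), of "\<rho> - \<epsilon>"] pos by (auto simp: \<rho>_def a_def \<epsilon>_def)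
    obtain k' where k': "\<sigma> - \<epsilon> < b k'"
      using less_cSUP_iff[OF _ bdd(2), of "\<sigma> - \<epsilon>"] pos by (auto simp: \<sigma>_def \<epsilon>_def)
    \<comment> \<open>With \<open>m + k = m' + k'\<close> both instances of \<open>R1\<close>
      contain the same value of \<open>C\<close>, so \<open>A m' + B k'\<close> exceeds
      \<open>A m + B k\<close> by at most 1.\<close>
    define k where "k = m' + k' - m"
    have "A m' + B k' \<le> A m + B k + 1"
      using R1[of m' k'] R1[of m k] by (auto simp: k_def)
    then have "of_int (A m' + B k') \<le> (of_int (A m + B k + 1) :: real)" by linarith
    then have "a m' + b k' \<le> a m + b k + 1"
      by (simp add: a_def b_def k_def algebra_simps)
    then show False using m' k' leb[of k] by (simp add: \<epsilon>_def field_simps)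
  qed
  then show ?thesis using le[of m] by (simp add: a_def)
qed

lemma gold_fractional_parts_dense:
  assumes "0 \<le> p" "p < q" "q \<le> 1"
  shows "\<exists>m::int. p < frac (of_int m * gold + x) \<and> frac (of_int m * gold + x) < q"
proof -
  obtain m n :: int where mn: "p < x + of_int m * gold + of_int n" "x + of_int m * gold + of_int n < q"
    using gold_orbit_dense[OF assms(2)] by blast
  have "frac (of_int m * gold + x) = x + of_int m * gold + of_int n"
    using assms mn by (subst frac_unique_iff) (auto simp: algebra_simps)
  then show ?thesis using mn by (intro exI[of _ m]) (simp only:)
qed

text \<open>\<open>R1\<close> with one index 0 brings \<open>A\<close>, \<open>B\<close>,
  \<open>C\<close> within 1 of each other, so \<open>A\<close> is nearly additive. \<open>R2\<close>
  with \<open>m = 0\<close> brings \<open>K\<close> near \<open>B\<close>, and with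
  \<open>k = 0\<close> it gives \<open>K (- m - A m)\<close> close to \<open>- m\<close>; together
  \<open>A (m + A m)\<close> is close to \<open>m\<close>. The constant 6 covers both
  errors.\<close>

lemma golden_sequences_bounded:
  fixes A B C K :: "int \<Rightarrow> int"
  assumes 0: "A 0 = 0" "B 0 = 0" and inc: "\<And>m. A (m + 1) - A m \<in> {0, 1}"
    and R1: "\<And>m k. C (m + k) - A m - B k \<in> {0, 1}"
    and R2: "\<And>m k. K (k - m - A m) - B k + m \<in> {0, 1}"
  obtains D where "\<And>m. \<bar>of_int (A m) - gold * of_int m\<bar> \<le> D" "\<And>m. \<bar>of_int (B m) - gold * of_int m\<bar> \<le> D"
proof -
  have AB: "\<bar>A m - B m\<bar> \<le> 1" for m
    using R1[of m 0] R1[of 0 m] 0 by auto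
  have KB: "\<bar>K j - B j\<bar> \<le> 1" for j
    using R2[of j 0] 0 by auto
  have add: "\<bar>A (m + n) - A m - A n\<bar> \<le> 6" for m n
    using R1[of "m + n" 0] R1[of m n] AB[of n] 0 by auto
  have "\<bar>A (m + A m) - m\<bar> \<le> 6" for m
  proof -
    have "\<bar>K (- m - A m) + m\<bar> \<le> 1"
      using R2[of 0 m] 0 by auto
    then have "\<bar>A (- (m + A m)) + m\<bar> \<le> 3"
      using KB[of "- m - A m"] AB[of "- m - A m"] by (simp add: algebra_simps)
    moreover have "\<bar>A (m + A m) + A (- (m + A m))\<bar> \<le> 2"
      using R1[of "m + A m" "- (m + A m)"] R1[of 0 0] AB[of "- (m + A m)"] 0 by auto
    ultimately show ?thesis by linarith
  qed
  from gold_multiple_bounded[OF 0(1) inc add this]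
  obtain D where D: "\<And>m. \<bar>of_int (A m) - gold * of_int m\<bar> \<le> D" by blast
  have "\<bar>of_int (B m) - gold * of_int m\<bar> \<le> D + 1" for m
  proof -
    have "\<bar>of_int (A m) - of_int (B m)\<bar> \<le> (1::real)" using AB[of m] by linarith
    then show ?thesis using D[of m] by linarith
  qed
  moreover have "\<bar>of_int (A m) - gold * of_int m\<bar> \<le> D + 1" for m
    using D[of m] by linarith
  ultimately show ?thesis using that by blast
qed

text \<open>For \<open>A m = \<lfloor>m * gold + \<rho>\<rfloor>\<close> this supremum is
  \<open>\<rho>\<close>, since the fractional parts of \<open>m * gold + \<rho>\<close> come
  arbitrarily close to 0.\<close>

definition phase :: "(int \<Rightarrow> int) \<Rightarrow> real" where
  "phase A = (SUP m. of_int (A m) - gold * of_int m)"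

text \<open>\<open>R1\<close> is symmetric in \<open>A\<close> and \<open>B\<close>, so the estimate
  applies to both. Each value is the floor of its argument, or possibly one less when that argument
  is an integer.\<close>

lemma golden_sequences_phase:
  fixes A B C K :: "int \<Rightarrow> int"
  assumes 0: "A 0 = 0" "B 0 = 0" and inc: "\<And>m. A (m + 1) - A m \<in> {0, 1}"
    and R1: "\<And>m k. C (m + k) - A m - B k \<in> {0, 1}"
    and R2: "\<And>m k. K (k - m - A m) - B k + m \<in> {0, 1}"
  shows "of_int m * gold + phase A - 1 \<le> of_int (A m)" "of_int (A m) \<le> of_int m * gold + phase A"
    and "of_int m * gold + phase B - 1 \<le> of_int (B m)" "of_int (B m) \<le> of_int m * gold + phase B"
proof -
  from golden_sequences_bounded[OF assms] obtain D where
    D: "\<And>m. \<bar>of_int (A m) - gold * of_int m\<bar> \<le> D" "\<And>m. \<bar>of_int (B m) - gold * of_int m\<bar> \<le> D" by blast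
  have R1': "C (m + k) - B m - A k \<in> {0, 1}" for m k
    using R1[of k m] by (simp add: algebra_simps)
  show "of_int m * gold + phase A - 1 \<le> of_int (A m)" "of_int (A m) \<le> of_int m * gold + phase A"
    using additive_triple_phase[of C A B, OF R1 D, of m] by (simp_all add: phase_def mult.commute)
  show "of_int m * gold + phase B - 1 \<le> of_int (B m)" "of_int (B m) \<le> of_int m * gold + phase B"
    using additive_triple_phase[of C B A, OF R1' D(2,1), of m] by (simp_all add: phase_def mult.commute)
qed

text \<open>The arguments of the four floors that give \<open>A\<close>, \<open>B\<close>,
  \<open>C\<close> and \<open>K\<close> from the phases have to avoid the integers.\<close>

definition gold_generic :: "real \<times> real \<Rightarrow> bool" where
  "gold_generic t \<longleftrightarrow> (\<forall>m n::int. of_int m * gold + fst t \<noteq> of_int n \<and> of_int m * gold + snd t \<noteq> of_int n \<and>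
     of_int m * gold + fst t + snd t \<noteq> of_int n \<and> of_int m * gold + snd t + gold * fst t \<noteq> of_int n)"

lemma golden_sequences_generic:
  fixes A B C K :: "int \<Rightarrow> int"
  assumes 0: "A 0 = 0" "B 0 = 0" and inc: "\<And>m. A (m + 1) - A m \<in> {0, 1}"
    and R1: "\<And>m k. C (m + k) - A m - B k \<in> {0, 1}"
    and R2: "\<And>m k. K (k - m - A m) - B k + m \<in> {0, 1}"
    and R3: "\<And>m k. C (m + k) - A m - m - K (k - m - A m) \<in> {0, 1}"
    and gen: "gold_generic (phase A, phase B)"
  defines "\<rho> \<equiv> phase A" and "\<sigma> \<equiv> phase B"
  shows "A m = \<lfloor>of_int m * gold + \<rho>\<rfloor>" and "B m = \<lfloor>of_int m * gold + \<sigma>\<rfloor>"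
    and "C m = \<lfloor>of_int m * gold + \<rho> + \<sigma>\<rfloor>" and "K m = \<lfloor>of_int m * gold + \<sigma> + gold * \<rho>\<rfloor>"
proof -
  note ph = golden_sequences_phase[OF 0 inc R1 R2]
  have n1: "of_int m * gold + \<rho> \<noteq> of_int n" and n2: "of_int m * gold + \<sigma> \<noteq> of_int n"
    and n3: "of_int m * gold + \<rho> + \<sigma> \<noteq> of_int n" and n4: "of_int m * gold + \<sigma> + gold * \<rho> \<noteq> of_int n" for m n :: int
    using gen by (auto simp: gold_generic_def \<rho>_def \<sigma>_def)
  have A: "A m = \<lfloor>of_int m * gold + \<rho>\<rfloor>" for m
  proof -
    have "of_int m * gold + \<rho> \<noteq> of_int (A m + 1)" by (rule n1)
    then show ?thesis using ph(1,2)[of m] by (intro floor_unique[symmetric]) (auto simp: \<rho>_def)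
  qed
  have B: "B m = \<lfloor>of_int m * gold + \<sigma>\<rfloor>" for m
  proof -
    have "of_int m * gold + \<sigma> \<noteq> of_int (B m + 1)" by (rule n2)
    then show ?thesis using ph(3,4)[of m] by (intro floor_unique[symmetric]) (auto simp: \<sigma>_def)
  qed
  \<comment> \<open>Along the antidiagonal \<open>m + k = l\<close>, the sum
    \<open>A m + B k\<close> is the floor of a fixed number minus a fractional part that is dense in
    the unit interval.\<close>
  have B_line: "B (l - m) = \<lfloor>(of_int l * gold + \<rho> + \<sigma>) - frac (of_int m * gold + \<rho>)\<rfloor> - A m" for l m
  proof -
    have "of_int (l - m) * gold + \<sigma> = (of_int l * gold + \<rho> + \<sigma>) - frac (of_int m * gold + \<rho>) - of_int (A m)"
      by (simp add: A frac_def algebra_simps)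
    then show ?thesis unfolding B by (simp only: floor_diff_of_int)
  qed
  have C: "C l = \<lfloor>of_int l * gold + \<rho> + \<sigma>\<rfloor>" for l
  proof -
    define z where "z = of_int l * gold + \<rho> + \<sigma>"
    have fz: "0 < frac z" "frac z < 1"
      using n3[of l] by (auto simp: z_def frac_lt_1 elim!: Ints_cases)
    \<comment> \<open>One fractional part below \<open>frac z\<close> and one above it make the sum
      take both values \<open>\<lfloor>z\<rfloor>\<close> and
      \<open>\<lfloor>z\<rfloor> - 1\<close>; \<open>R1\<close> at both sites leaves a single value
      for \<open>C l\<close>.\<close>
    obtain m where m: "frac (of_int m * gold + \<rho>) < frac z"
      using gold_fractional_parts_dense[of 0 "frac z" \<rho>] fz by auto
    obtain m' where m': "frac z < frac (of_int m' * gold + \<rho>)"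
      using gold_fractional_parts_dense[of "frac z" 1 \<rho>] fz by auto
    have "\<lfloor>z - frac (of_int m * gold + \<rho>)\<rfloor> = \<lfloor>z\<rfloor>"
      using m frac_ge_0[of "of_int m * gold + \<rho>"] frac_lt_1[of z] unfolding frac_def[of z]
      by (intro floor_unique) linarith+
    moreover have "\<lfloor>z - frac (of_int m' * gold + \<rho>)\<rfloor> = \<lfloor>z\<rfloor> - 1"
      using m' frac_ge_0[of z] frac_lt_1[of "of_int m' * gold + \<rho>"] unfolding frac_def[of z]
      by (intro floor_unique; simp; linarith)
    ultimately show ?thesis
      using R1[of m "l - m"] R1[of m' "l - m'"] B_line[of l m] B_line[of l m'] by (auto simp: z_def)
  qed
  have K: "K j = \<lfloor>of_int j * gold + \<sigma> + gold * \<rho>\<rfloor>" for j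
  proof -
    define y where "y = of_int j * gold + \<sigma> + gold * \<rho>"
    have fy: "0 < frac y" "frac y < 1"
      using n4[of j] by (auto simp: y_def frac_lt_1 elim!: Ints_cases)
    \<comment> \<open>This is the distance from \<open>y\<close> to the nearest integer. When
      \<open>\<theta>\<close> is smaller, \<open>y - gold * \<theta>\<close> and
      \<open>y + (1 - gold) * \<theta>\<close> have the same floor as \<open>y\<close>, so that
      \<open>R2\<close> and \<open>R3\<close> bound \<open>K j\<close> by it from opposite
      sides.\<close>
    define \<delta> where "\<delta> = min (frac y) (1 - frac y)"
    have "0 < \<delta>" "\<delta> \<le> 1" using fy by (auto simp: \<delta>_def)
    then obtain m where m: "frac (of_int m * gold + \<rho>) < \<delta>"
      using gold_fractional_parts_dense[of 0 \<delta> \<rho>] by auto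
    define \<theta> where "\<theta> = frac (of_int m * gold + \<rho>)"
    define k where "k = j + m + A m"
    have \<theta>: "0 \<le> \<theta>" "\<theta> < frac y" "\<theta> < 1 - frac y" using m by (simp_all add: \<theta>_def \<delta>_def)
    have Am: "of_int (A m) = of_int m * gold + \<rho> - \<theta>" by (simp add: \<theta>_def frac_def A)
    have "of_int k * gold + \<sigma> = y + of_int m * (gold + gold * gold) - gold * \<theta>"
      by (simp add: k_def Am y_def algebra_simps)
    then have kq: "of_int k * gold + \<sigma> = y - gold * \<theta> + of_int m" by (simp add: gold_square)
    have g\<theta>: "0 \<le> gold * \<theta>" "gold * \<theta> \<le> \<theta>"
      using \<theta>(1) gold_pos gold_less_1 by (auto intro: mult_left_le_one_le)
    have "B k - m = \<lfloor>y - gold * \<theta>\<rfloor>" unfolding B kq by simp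
    also have "\<dots> = \<lfloor>y\<rfloor>"
      using g\<theta> \<theta> frac_lt_1[of y] unfolding frac_def[of y] by (intro floor_unique) linarith+
    finally have 1: "B k - m = \<lfloor>y\<rfloor>" .
    have "of_int (m + k) * gold + \<rho> + \<sigma> = y + (1 - gold) * \<theta> + of_int (A m + m)"
      using kq by (simp add: Am algebra_simps)
    then have "C (m + k) - A m - m = \<lfloor>y + (1 - gold) * \<theta>\<rfloor>" unfolding C by simp
    also have "\<dots> = \<lfloor>y\<rfloor>"
    proof -
      have "0 \<le> (1 - gold) * \<theta>" "(1 - gold) * \<theta> \<le> \<theta>"
        using g\<theta> by (simp_all add: algebra_simps)
      then show ?thesis
        using \<theta> unfolding frac_def[of y] by (intro floor_unique) linarith+
    qed
    finally show ?thesis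
      using 1 R2[of k m] R3[of m k] by (auto simp: k_def y_def)
  qed
  show "A m = \<lfloor>of_int m * gold + \<rho>\<rfloor>" "B m = \<lfloor>of_int m * gold + \<sigma>\<rfloor>"
    "C m = \<lfloor>of_int m * gold + \<rho> + \<sigma>\<rfloor>" "K m = \<lfloor>of_int m * gold + \<sigma> + gold * \<rho>\<rfloor>"
    by (rule A B C K)+
qed


section \<open>Rotation-invariant measures\<close>

text \<open>Haar measure of the circle, carried by the fundamental domain \<open>{0..<1}\<close> of
  the real line; rotations become \<open>frac (x + c)\<close>.\<close>

definition unif :: "real measure" where
  "unif = uniform_measure lborel {0..<1}"

lemma sets_unif [measurable_cong, simp]: "sets unif = sets borel"
  and space_unif [simp]: "space unif = UNIV"
  by (simp_all add: unif_def)

lemma emeasure_unif: "A \<in> sets borel \<Longrightarrow> emeasure unif A = emeasure lborel ({0..<1} \<inter> A)"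
  by (simp add: unif_def divide_ennreal_def)

interpretation unif: prob_space unif
  unfolding unif_def by (rule prob_space_uniform_measure) simp_all

interpretation unif2: pair_prob_space unif unif ..

lemma frac_add_frac: "frac (frac x + y) = frac (x + y :: real)"
  by (simp add: frac_def algebra_simps)

lemma measurable_frac [measurable]: "(frac :: real \<Rightarrow> real) \<in> borel_measurable borel"
  unfolding frac_def by measurable

lemma emeasure_lborel_translate:
  "A \<in> sets borel \<Longrightarrow> emeasure lborel {x::real. x + c \<in> A} = emeasure lborel A"
  using emeasure_distr[of "(+) c" lborel borel A] by (simp add: lborel_distr_plus vimage_def add.commute)

text \<open>On the unit interval a rotation exchanges two intervals, translating one by
  \<open>d\<close> and the other by \<open>d - 1\<close>.\<close>

lemma emeasure_unif_rotation:
  assumes [measurable]: "A \<in> sets borel"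
  shows "emeasure unif {x. frac (x + c) \<in> A} = emeasure unif A"
proof -
  define d where "d = frac c"
  have d: "0 \<le> d" "d < 1" by (simp_all add: d_def frac_lt_1)
  have eq: "{0..<1} \<inter> {x. frac (x + c) \<in> A} =
      {x. x + d \<in> {d..<1} \<inter> A} \<union> {x. x + (d - 1) \<in> {0..<d} \<inter> A}"
  proof -
    have "frac (x + c) = (if x + d < 1 then x + d else x + (d - 1))" if "0 \<le> x" "x < 1" for x
    proof -
      have "frac (x + c) = frac (x + d)"
        using frac_add_frac[of c x] by (simp add: d_def add.commute)
      also have "\<dots> = (if x + d < 1 then x + d else x + (d - 1))"
        using that d by (auto simp: frac_unique_iff)
      finally show ?thesis .
    qed
    then show ?thesis using d by (auto split: if_splits)
  qed
  have "emeasure unif {x. frac (x + c) \<in> A} =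
      emeasure lborel {x. x + d \<in> {d..<1} \<inter> A} + emeasure lborel {x. x + (d - 1) \<in> {0..<d} \<inter> A}"
    unfolding emeasure_unif[of "{x. frac (x + c) \<in> A}", simplified] eq
    using d by (intro plus_emeasure[symmetric]) auto
  also have "\<dots> = emeasure lborel ({d..<1} \<inter> A) + emeasure lborel ({0..<d} \<inter> A)"
    by (intro arg_cong2[where f="(+)"] emeasure_lborel_translate) simp_all
  also have "\<dots> = emeasure lborel (({d..<1} \<inter> A) \<union> ({0..<d} \<inter> A))"
    by (intro plus_emeasure) auto
  also have "({d..<1} \<inter> A) \<union> ({0..<d} \<inter> A) = {0..<1} \<inter> A" using d by auto
  finally show ?thesis by (simp add: emeasure_unif)
qed

lemma distr_unif_rotation: "distr unif borel (\<lambda>x. frac (x + c)) = unif"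
  by (rule measure_eqI) (auto simp: emeasure_distr vimage_def emeasure_unif_rotation)

lemma emeasure_unif_lessThan: "0 \<le> t \<Longrightarrow> t \<le> 1 \<Longrightarrow> emeasure unif {..<t} = ennreal t"
proof -
  assume t: "0 \<le> t" "t \<le> 1"
  then have "{0..<1} \<inter> {..<t} = {0..<t}" by auto
  then show ?thesis using t by (simp add: emeasure_unif)
qed

lemma emeasure_unif_countable:
  assumes "countable A"
  shows "emeasure unif A = 0"
proof -
  have "A \<in> sets borel" by (rule sets.countable[OF _ assms]) simp
  then show ?thesis
    using emeasure_lborel_countable[OF countable_subset[OF Int_lower2 assms]] by (simp add: emeasure_unif)
qed

text \<open>Under a measure invariant by the rotation, the mass of the arc \<open>{s. frac (s + x) < t}\<close> is
  invariant under translation of \<open>x\<close> by a dense group and right continuous in \<open>x\<close>, hence constant;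
  averaging over \<open>x\<close> gives its value.\<close>

lemma rotation_invariant_lessThan:
  fixes M :: "real measure"
  assumes "finite_measure M" and sets: "sets M = sets borel"
    and carr: "emeasure M (- {0..<1}) = 0"
    and inv: "\<And>A. A \<in> sets borel \<Longrightarrow> emeasure M {x. frac (x + gold) \<in> A} = emeasure M A"
    and t: "0 \<le> t" "t \<le> 1"
  shows "emeasure M {..<t} = emeasure M UNIV * ennreal t"
proof -
  interpret M: finite_measure M by fact
  note [measurable_cong] = sets
  have space: "space M = UNIV" using sets_eq_imp_space_eq[OF sets] by simp
  define h where "h x = measure M {s. frac (s + x) < t}" for x
  have step: "h (x + gold) = h x" for x
  proof -
    have "measure M {s. frac (s + gold) \<in> {s. frac (s + x) < t}} = measure M {s. frac (s + x) < t}"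
      unfolding measure_def by (subst inv) (auto simp: space)
    then show ?thesis by (simp add: h_def frac_add_frac ac_simps)
  qed
  have step_int: "h (x + of_int m * gold) = h x" for x m
  proof (induction m rule: int_induct[of _ 0])
    case (step1 i) then show ?case using step[of "x + of_int i * gold"] by (simp add: algebra_simps)
  next
    case (step2 i) then show ?case using step[of "x + of_int (i - 1) * gold"] by (simp add: algebra_simps)
  qed simp
  have orbit: "h (of_int m * gold + of_int n) = h 0" for m n
  proof -
    have "h (x + of_int n) = h x" for x
      by (simp add: h_def frac_def add.assoc[symmetric])
    then show ?thesis using step_int[of 0 m] by simp
  qed
  have const: "h x = h 0" for x
  proof -
    \<comment> \<open>Orbit points are taken to the right of \<open>x\<close>, because
      \<open>h\<close> is shown to be continuous from that side.\<close>
    have "\<exists>y. x < y \<and> y < x + 1 / real (Suc i) \<and> h y = h 0" for i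
    proof -
      obtain m n :: int where "x < 0 + of_int m * gold + of_int n" "0 + of_int m * gold + of_int n < x + 1 / real (Suc i)"
        using gold_orbit_dense[of x "x + 1 / real (Suc i)" 0] by auto
      then show ?thesis using orbit[of m n] by (intro exI[of _ "of_int m * gold + of_int n"]) simp
    qed
    then obtain y where y: "\<And>i. x < y i" "\<And>i. y i < x + 1 / real (Suc i)" "\<And>i. h (y i) = h 0" by metis
    have lim: "(\<lambda>i. indicator {s. frac (s + y i) < t} s :: real) \<longlonglongrightarrow> indicator {s. frac (s + x) < t} s" for s
    proof -
      \<comment> \<open>The distance by which \<open>s + x\<close> may move right without leaving
        the arc or, if it lies outside, without passing an integer and entering it.\<close>
      define \<delta> where "\<delta> = (if frac (s + x) < t then t - frac (s + x) else 1 - frac (s + x))"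
      have \<delta>: "0 < \<delta>" by (simp add: \<delta>_def frac_lt_1)
      then obtain N where N: "1 / real (Suc N) < \<delta>" using nat_approx_posE by blast
      have "indicator {s. frac (s + y i) < t} s = (indicator {s. frac (s + x) < t} s :: real)" if "i \<ge> N" for i
      proof -
        have "1 / real (Suc i) \<le> 1 / real (Suc N)" using that by (simp add: frac_le)
        then have yi: "x < y i" "y i < x + \<delta>" using y(1,2)[of i] N by linarith+
        have "frac (s + y i) = frac (s + x) + (y i - x)"
        proof -
          have "0 \<le> frac (s + x) + (y i - x)" using yi by simp
          moreover have "frac (s + x) + (y i - x) < 1" using yi t by (auto simp: \<delta>_def split: if_splits)
          moreover have "s + y i - (frac (s + x) + (y i - x)) \<in> \<int>" by (simp add: frac_def)
          ultimately show ?thesis by (simp add: frac_unique_iff)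
        qed
        then show ?thesis using yi by (auto simp: \<delta>_def indicator_def split: if_splits)
      qed
      then show ?thesis
        by (intro tendsto_eventually) (auto simp: eventually_sequentially)
    qed
    have "(\<lambda>i. \<integral>s. indicator {s. frac (s + y i) < t} s \<partial>M) \<longlonglongrightarrow> (\<integral>s. (indicator {s. frac (s + x) < t} s :: real) \<partial>M)"
      by (rule integral_dominated_convergence[where w="\<lambda>_. 1"]) (auto intro!: lim)
    then have "(\<lambda>i. h (y i)) \<longlonglongrightarrow> h x"
      by (simp add: h_def space)
    then have "(\<lambda>i. h 0) \<longlonglongrightarrow> h x" by (simp add: y(3))
    then show ?thesis using LIMSEQ_unique tendsto_const by metis
  qed
  \<comment> \<open>Fubini for \<open>Q\<close>: its slices at fixed \<open>x\<close> have mass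
    \<open>h x = h 0\<close> under \<open>M\<close>, its slices at fixed \<open>s\<close> have mass
    \<open>t\<close> under \<open>unif\<close>.\<close>
  interpret P: pair_sigma_finite unif M ..
  define Q where "Q = {(x, s). frac (s + x) < t}"
  have Q: "Q \<in> sets (unif \<Otimes>\<^sub>M M)"
  proof -
    have "{p \<in> space (unif \<Otimes>\<^sub>M M). frac (snd p + fst p) < t} \<in> sets (unif \<Otimes>\<^sub>M M)" by measurable
    also have "{p \<in> space (unif \<Otimes>\<^sub>M M). frac (snd p + fst p) < t} = Q"
      by (auto simp: Q_def space_pair_measure space)
    finally show ?thesis .
  qed
  have "emeasure (unif \<Otimes>\<^sub>M M) Q = (\<integral>\<^sup>+x. ennreal (h 0) \<partial>unif)"
    unfolding M.emeasure_pair_measure_alt[OF Q]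
  proof (rule nn_integral_cong)
    fix x
    have "emeasure M (Pair x -` Q) = ennreal (h x)"
      by (simp add: Q_def h_def M.emeasure_eq_measure vimage_def)
    then show "emeasure M (Pair x -` Q) = ennreal (h 0)" using const[of x] by simp
  qed
  also have "\<dots> = ennreal (h 0)" using unif.emeasure_space_1 by simp
  finally have 1: "emeasure (unif \<Otimes>\<^sub>M M) Q = ennreal (h 0)" .
  have "emeasure (unif \<Otimes>\<^sub>M M) Q = (\<integral>\<^sup>+s. ennreal t \<partial>M)"
    unfolding P.emeasure_pair_measure_alt2[OF Q]
  proof (rule nn_integral_cong)
    fix s
    have "emeasure unif {x. frac (x + s) \<in> {..<t}} = ennreal t"
      using t by (subst emeasure_unif_rotation) (auto simp: emeasure_unif_lessThan)
    then show "emeasure unif ((\<lambda>x. (x, s)) -` Q) = ennreal t"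
      by (simp add: Q_def vimage_def add.commute)
  qed
  also have "\<dots> = emeasure M UNIV * ennreal t" by (simp add: space mult.commute)
  finally have 2: "emeasure M UNIV * ennreal t = ennreal (h 0)" using 1 by simp
  have "emeasure M {..<t} = emeasure M {s. frac (s + 0) < t}"
  proof (rule emeasure_eq_AE)
    show "AE s in M. s \<in> {..<t} \<longleftrightarrow> s \<in> {s. frac (s + 0) < t}"
    proof (rule AE_I')
      show "- {0..<1} \<in> null_sets M" using carr by (auto simp: null_sets_def sets)
    qed (auto simp: frac_eq space)
  qed (auto simp: sets)
  also have "\<dots> = ennreal (h 0)" by (simp only: h_def M.emeasure_eq_measure)
  finally show ?thesis using 2 by simp
qed

text \<open>The half-lines form an intersection-stable generator. The total mass is left arbitrary
  for the application to slices of a measure on the torus.\<close>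

lemma rotation_invariant_unif:
  fixes M :: "real measure"
  assumes "finite_measure M" and sets: "sets M = sets borel"
    and carr: "emeasure M (- {0..<1}) = 0"
    and inv: "\<And>A. A \<in> sets borel \<Longrightarrow> emeasure M {x. frac (x + gold) \<in> A} = emeasure M A"
    and A: "A \<in> sets borel"
  shows "emeasure M A = emeasure M UNIV * emeasure unif A"
proof -
  interpret M: finite_measure M by fact
  have space: "space M = UNIV" using sets_eq_imp_space_eq[OF sets] by simp
  define c where "c = emeasure M UNIV"
  have c: "c < \<infinity>" by (simp add: c_def less_top[symmetric])
  have le0: "emeasure M {..<t} = 0" if "t < 0" for t
  proof -
    have "emeasure M {..<t} \<le> emeasure M (- {0..<1})" using that by (intro emeasure_mono) (auto simp: sets)
    then show ?thesis using carr by simp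
  qed
  define N where "N = density unif (\<lambda>_. c)"
  have emN: "emeasure N B = c * emeasure unif B" if "B \<in> sets borel" for B
    using that by (simp add: N_def emeasure_density_const)
  have N: "finite_measure N"
    by (rule finite_measureI) (use c unif.emeasure_space_1 in \<open>auto simp: emN N_def emeasure_density_const\<close>)
  have lt: "emeasure M {..<t} = emeasure N {..<t}" for t
  proof -
    consider "t < 0" | "0 \<le> t" "t \<le> 1" | "1 < t" by linarith
    then show ?thesis
    proof cases
      case 1
      then have "{0..<1} \<inter> {..<t} = {}" by auto
      then show ?thesis using le0[OF 1] by (simp add: emN emeasure_unif)
    next
      case 2
      then show ?thesis
        using rotation_invariant_lessThan[OF assms(1-4) 2] by (simp add: emN c_def emeasure_unif_lessThan)
    next
      case 3
      have "emeasure M {..<1} \<le> emeasure M {..<t}" "emeasure M {..<t} \<le> c"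
        unfolding c_def using 3 by (auto intro!: emeasure_mono simp: sets)
      moreover have "emeasure M {..<1} = c"
        using rotation_invariant_lessThan[OF assms(1-4), of 1] by (simp add: c_def)
      moreover have "{0..<1} \<inter> {..<t} = {0..<1::real}" using 3 by auto
      ultimately show ?thesis by (simp add: emN emeasure_unif)
    qed
  qed
  have "M = N"
  proof (rule measure_eqI_generator_eq[where \<Omega>=UNIV and E="range lessThan" and A="\<lambda>i. {..<real i}"])
    have "{..<a} \<inter> {..<b} = {..<min a b}" for a b :: real by auto
    then show "Int_stable (range (lessThan :: real \<Rightarrow> _))"
      by (auto simp: Int_stable_def)
    show "sets M = sigma_sets UNIV (range lessThan)" "sets N = sigma_sets UNIV (range lessThan)"
      by (simp_all add: sets N_def borel_Iio)
    show "(\<Union>i. {..<real i}) = UNIV" using reals_Archimedean2 by auto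
  qed (auto simp: lt finite_measure.emeasure_finite[OF N])
  then show ?thesis using emN[OF A] by (simp add: c_def)
qed

lemma emeasure_0_AE:
  assumes "X \<in> sets M" "AE x in M. x \<notin> X"
  shows "emeasure M X = 0"
proof -
  have "emeasure M X = emeasure M {}"
    using assms by (intro emeasure_eq_AE) auto
  then show ?thesis by simp
qed

text \<open>Each coordinate can be rotated alone. For fixed \<open>B\<close> the slice in the first
  coordinate is a multiple of \<open>unif\<close>, and its total mass is the value at
  \<open>B\<close> of the second marginal, which is \<open>unif\<close> as well; so \<open>N\<close>
  is a product on rectangles.\<close>

lemma torus_rotation_invariant:
  fixes N :: "(real \<times> real) measure"
  assumes "prob_space N" and sets: "sets N = sets (borel \<Otimes>\<^sub>M borel)"
    and carr: "AE t in N. fst t \<in> {0..<1} \<and> snd t \<in> {0..<1}"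
    and inv1: "\<And>A B. A \<in> sets borel \<Longrightarrow> B \<in> sets borel \<Longrightarrow>
        emeasure N ({x. frac (x + gold) \<in> A} \<times> B) = emeasure N (A \<times> B)"
    and inv2: "\<And>A B. A \<in> sets borel \<Longrightarrow> B \<in> sets borel \<Longrightarrow>
        emeasure N (A \<times> {x. frac (x + gold) \<in> B}) = emeasure N (A \<times> B)"
  shows "N = unif \<Otimes>\<^sub>M unif"
proof -
  interpret N: prob_space N by fact
  note [measurable_cong] = sets
  have space: "space N = UNIV" using sets_eq_imp_space_eq[OF sets] by (simp add: space_pair_measure)
  have row: "emeasure N (A \<times> B) = emeasure N (UNIV \<times> B) * emeasure unif A"
    if A: "A \<in> sets borel" and B [measurable]: "B \<in> sets borel" for A B
  proof -
    define M where "M = distr (restrict_space N (UNIV \<times> B)) borel fst"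
    have UB: "UNIV \<times> B \<in> sets N" by (simp add: sets)
    have em: "emeasure M C = emeasure N (C \<times> B)" if "C \<in> sets borel" for C
    proof -
      have "emeasure M C = emeasure (restrict_space N (UNIV \<times> B)) (fst -` C \<inter> space (restrict_space N (UNIV \<times> B)))"
        unfolding M_def using that by (intro emeasure_distr) (auto intro!: measurable_restrict_space1)
      also have "fst -` C \<inter> space (restrict_space N (UNIV \<times> B)) = C \<times> B"
        by (auto simp: space_restrict_space space)
      finally show ?thesis using UB by (subst (asm) emeasure_restrict_space) (auto simp: space)
    qed
    have "emeasure M A = emeasure M UNIV * emeasure unif A"
    proof (rule rotation_invariant_unif)
      show "finite_measure M" by (rule finite_measureI) (simp add: M_def em[unfolded M_def])
      have "emeasure N ((- {0..<1}) \<times> B) = 0"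
        using carr by (intro emeasure_0_AE) (auto simp: sets elim: eventually_mono)
      then show "emeasure M (- {0..<1}) = 0" by (simp add: em)
      show "emeasure M {x. frac (x + gold) \<in> C} = emeasure M C" if "C \<in> sets borel" for C
        using that by (simp add: em inv1)
    qed (auto simp: M_def A)
    then show ?thesis by (simp add: em A)
  qed
  have col: "emeasure N (UNIV \<times> B) = emeasure unif B" if B: "B \<in> sets borel" for B
  proof -
    define M where "M = distr N borel snd"
    have em: "emeasure M C = emeasure N (UNIV \<times> C)" if "C \<in> sets borel" for C
      using that by (auto simp: M_def emeasure_distr space intro!: arg_cong[where f="emeasure N"])
    have "emeasure M B = emeasure M UNIV * emeasure unif B"
    proof (rule rotation_invariant_unif)
      show "finite_measure M" unfolding M_def by (rule N.finite_measure_distr) simp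
      have "emeasure N (UNIV \<times> (- {0..<1})) = 0"
        using carr by (intro emeasure_0_AE) (auto simp: sets elim: eventually_mono)
      then show "emeasure M (- {0..<1}) = 0" by (simp add: em)
      show "emeasure M {x. frac (x + gold) \<in> C} = emeasure M C" if "C \<in> sets borel" for C
        using that inv2[of UNIV C] by (simp add: em)
    qed (auto simp: M_def B)
    then show ?thesis using N.emeasure_space_1 by (simp add: em B space)
  qed
  show ?thesis
  proof (rule pair_measure_eqI[symmetric])
    show "sigma_finite_measure unif" "sigma_finite_measure unif" by unfold_locales
    show "sets (unif \<Otimes>\<^sub>M unif) = sets N" by (simp add: sets cong: sets_pair_measure_cong)
    show "emeasure unif A * emeasure unif B = emeasure N (A \<times> B)" if "A \<in> sets unif" "B \<in> sets unif" for A B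
      using that row[of A B] col[of B] by (simp add: mult.commute)
  qed
qed

lemma distr_unif2_rotation:
  "distr (unif \<Otimes>\<^sub>M unif) (borel \<Otimes>\<^sub>M borel) (\<lambda>(x, y). (frac (x + c), frac (y + d))) = unif \<Otimes>\<^sub>M unif"
  using pair_measure_distr[of "\<lambda>x. frac (x + c)" unif borel "\<lambda>x. frac (x + d)" unif borel]
  by (simp add: distr_unif_rotation unif.sigma_finite_measure_axioms)


section \<open>Two-dimensional arrays\<close>

text \<open>The discrete antiderivative of \<open>f\<close> that vanishes at 0; the second sum
  extends it to negative \<open>m\<close>.\<close>

definition height :: "(int \<Rightarrow> int) \<Rightarrow> int \<Rightarrow> int" where
  "height f m = (\<Sum>i\<in>{0..<m}. f i) - (\<Sum>i\<in>{m..<0}. f i)"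

lemma height_0 [simp]: "height f 0 = 0"
  by (simp add: height_def)

lemma height_step: "height f (m + 1) = height f m + f m"
proof (cases "0 \<le> m")
  case True
  then have "{0..<m + 1} = insert m {0..<m}" "{m..<0} = {}" "{m + 1..<0} = {}" by auto
  then show ?thesis by (simp add: height_def)
next
  case False
  then have "{m..<0} = insert m {m + 1..<0}" "{0..<m} = {}" "{0..<m + 1} = {}" by auto
  then show ?thesis by (simp add: height_def)
qed

lemma int_step_constant:
  fixes f :: "int \<Rightarrow> 'b"
  assumes "\<And>m. f (m + 1) = f m"
  shows "f m = f 0"
proof (induction m rule: int_induct[of _ 0])
  case (step1 i) then show ?case using assms[of i] by simp
next
  case (step2 i) then show ?case using assms[of "i - 1"] by simp
qed simp

text \<open>The six entries of an array at \<open>(m, k)\<close> are the increments \<open>A (m + 1) - A m\<close>, \<open>B (k + 1) - B k\<close>,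
  \<open>C (l + 1) - C l\<close> for \<open>l = m + k\<close>, \<open>K (j + 1) - K j\<close> for \<open>j = k - m - A m\<close>, and the differences
  \<open>K j - B k + m\<close> and \<open>C l - A m - m - K j\<close>. Moving from \<open>(m, k)\<close> to \<open>(m + 1, k + 1 + A (m + 1) - A m)\<close>
  preserves \<open>j\<close>.\<close>

definition local_rule :: "(nat \<Rightarrow> int \<Rightarrow> int \<Rightarrow> int) \<Rightarrow> bool" where
  "local_rule s \<longleftrightarrow>
     s 0 0 1 = s 0 0 0 \<and> s 1 1 0 = s 1 0 0 \<and> s 2 1 0 = s 2 0 1 \<and>
     (if s 0 0 0 = 1 then s 3 1 2 else s 3 1 1) = s 3 0 0 \<and>
     s 4 0 1 = s 4 0 0 + s 3 0 0 - s 1 0 0 \<and>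
     (if s 0 0 0 = 1 then s 4 1 2 = s 4 0 0 + 1 - s 1 0 0 - s 1 0 1 else s 4 1 1 = s 4 0 0 + 1 - s 1 0 0) \<and>
     s 5 0 1 = s 5 0 0 + s 2 0 0 - s 3 0 0 \<and>
     s 4 1 0 + s 5 1 0 = s 4 0 0 + s 5 0 0 + s 2 0 0 - s 0 0 0 \<and>
     s 4 0 0 + s 5 0 0 \<le> 1"

definition golden_array :: "(nat \<Rightarrow> int \<Rightarrow> int \<Rightarrow> int) \<Rightarrow> bool" where
  "golden_array s \<longleftrightarrow> (\<forall>i m k. s i m k \<in> {0, 1}) \<and> (\<forall>m k. local_rule (\<lambda>i m' k'. s i (m + m') (k + k')))"

text \<open>Entries 0 to 3 are constant along columns, rows, antidiagonals and the lines of constant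
  \<open>k - m - A m\<close>, so each descends to a sequence. The additive constants of
  \<open>C\<close> and \<open>K\<close> are dictated by the entries 4 and 5 at the origin, where
  \<open>A\<close> and \<open>B\<close> vanish.\<close>

lemma golden_array_heights:
  assumes s: "golden_array s"
  defines "A \<equiv> height (\<lambda>m. s 0 m 0)" and "B \<equiv> height (\<lambda>k. s 1 0 k)"
    and "C \<equiv> \<lambda>l. s 4 0 0 + s 5 0 0 + height (\<lambda>l. s 2 0 l) l"
    and "K \<equiv> \<lambda>j. s 4 0 0 + height (\<lambda>j. s 3 0 j) j"
  shows "s 0 m k = A (m + 1) - A m" and "s 1 m k = B (k + 1) - B k"
    and "s 2 m k = C (m + k + 1) - C (m + k)"
    and "s 3 m k = K (k - m - A m + 1) - K (k - m - A m)"
    and "s 4 m k = K (k - m - A m) - B k + m"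
    and "s 5 m k = C (m + k) - A m - m - K (k - m - A m)"
proof -
  have bit: "s i m k = 0 \<or> s i m k = 1" for i m k
    using s by (auto simp: golden_array_def)
  have L: "s 0 m (k + 1) = s 0 m k" "s 1 (m + 1) k = s 1 m k" "s 2 (m + 1) k = s 2 m (k + 1)"
     "s 3 (m + 1) (k + 1 + s 0 m k) = s 3 m k"
     "s 4 m (k + 1) = s 4 m k + s 3 m k - s 1 m k"
     "s 4 (m + 1) (k + 1 + s 0 m k) = s 4 m k + 1 - s 1 m k - s 0 m k * s 1 m (k + 1)"
     "s 5 m (k + 1) = s 5 m k + s 2 m k - s 3 m k"
     "s 4 (m + 1) k + s 5 (m + 1) k = s 4 m k + s 5 m k + s 2 m k - s 0 m k" for m k
  proof -
    have "local_rule (\<lambda>i m' k'. s i (m + m') (k + k'))" using s by (simp add: golden_array_def)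
    then show "s 0 m (k + 1) = s 0 m k" "s 1 (m + 1) k = s 1 m k" "s 2 (m + 1) k = s 2 m (k + 1)"
     "s 3 (m + 1) (k + 1 + s 0 m k) = s 3 m k"
     "s 4 m (k + 1) = s 4 m k + s 3 m k - s 1 m k"
     "s 4 (m + 1) (k + 1 + s 0 m k) = s 4 m k + 1 - s 1 m k - s 0 m k * s 1 m (k + 1)"
     "s 5 m (k + 1) = s 5 m k + s 2 m k - s 3 m k"
     "s 4 (m + 1) k + s 5 (m + 1) k = s 4 m k + s 5 m k + s 2 m k - s 0 m k"
      using bit[of 0 m k] by (auto simp: local_rule_def add.assoc)
  qed
  have A0: "A 0 = 0" and B0: "B 0 = 0" by (simp_all add: A_def B_def)
  have a: "s 0 m k = s 0 m 0" for m k
    by (rule int_step_constant[where f="\<lambda>k. s 0 m k"]) (rule L)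
  have b: "s 1 m k = s 1 0 k" for m k
    by (rule int_step_constant[where f="\<lambda>m. s 1 m k"]) (rule L)
  have g: "s 2 m k = s 2 0 (m + k)" for m k
    using int_step_constant[where f="\<lambda>m'. s 2 m' (m + k - m')" and m=m] L(3) by (simp add: algebra_simps)
  have A: "A (m + 1) = A m + s 0 m k" for m k
    unfolding A_def height_step using a[of m k] by simp
  have B: "B (k + 1) = B k + s 1 m k" for m k
    unfolding B_def height_step using b[of m k] by simp
  have C: "C (l + 1) = C l + s 2 m (l - m)" for m l
    unfolding C_def height_step using g[of m "l - m"] by simp
  have kap: "s 3 m (k + m + A m) = s 3 0 k" for m k
  proof -
    have "s 3 (m + 1) (k + (m + 1) + A (m + 1)) = s 3 m (k + m + A m)" for m
    proof -
      have "k + (m + 1) + A (m + 1) = k + m + A m + 1 + s 0 m (k + m + A m)"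
        by (simp add: A[of m "k + m + A m"])
      then show ?thesis by (simp only: L(4))
    qed
    from int_step_constant[where f="\<lambda>m. s 3 m (k + m + A m)", OF this] show ?thesis by (simp add: A0)
  qed
  have K: "K (j + 1) = K j + s 3 m (j + m + A m)" for m j
    unfolding K_def height_step by (simp add: kap)
  have e: "s 4 m (k + m + A m) = K k - B (k + m + A m) + m" for m k
  proof -
    \<comment> \<open>The error of the claimed formula does not change along the line of
      \<open>k\<close>, nor from line to line on the column \<open>m = 0\<close>, and it vanishes at
      the origin.\<close>
    define f where "f m k = s 4 m (k + m + A m) - (K k - B (k + m + A m) + m)" for m k
    have "f (m + 1) k = f m k" for m
    proof -
      let ?k = "k + m + A m"
      \<comment> \<open>The step along the line raises the row index by one or two, so
        \<open>B\<close> gains one or two increments.\<close>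
      have "B (?k + 1 + s 0 m ?k) = B ?k + s 1 m ?k + s 0 m ?k * s 1 m (?k + 1)"
        using bit[of 0 m ?k] B[of ?k m] B[of "?k + 1" m] by auto
      moreover have eq: "k + (m + 1) + A (m + 1) = ?k + 1 + s 0 m ?k" by (simp add: A[of m ?k])
      ultimately show ?thesis using L(6)[of m ?k] unfolding f_def eq by linarith
    qed
    from int_step_constant[where f="\<lambda>m. f m k", OF this] have "f m k = f 0 k" by simp
    also have "f 0 k = f 0 0"
    proof (rule int_step_constant[where f="\<lambda>k. f 0 k"])
      show "f 0 (k + 1) = f 0 k" for k
        using L(5)[of 0 k] B[of k 0] K[of k 0] by (simp add: f_def A0)
    qed
    also have "f 0 0 = 0" by (simp add: f_def K_def A0 B0)
    finally show ?thesis by (simp add: f_def)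
  qed
  have c: "s 4 m k + s 5 m k = C (m + k) - A m - B k" for m k
  proof -
    define f where "f m k = s 4 m k + s 5 m k - (C (m + k) - A m - B k)" for m k
    have "f (m + 1) k = f m k" for m
      using L(8)[of m k] A[of m k] C[of "m + k" m] by (simp add: f_def algebra_simps)
    from int_step_constant[where f="\<lambda>m. f m k", OF this] have "f m k = f 0 k" by simp
    also have "f 0 k = f 0 0"
    proof (rule int_step_constant[where f="\<lambda>k. f 0 k"])
      show "f 0 (k + 1) = f 0 k" for k
        using L(5)[of 0 k] L(7)[of 0 k] B[of k 0] C[of k 0] by (simp add: f_def)
    qed
    also have "f 0 0 = 0" by (simp add: f_def C_def A0 B0)
    finally show ?thesis by (simp add: f_def)
  qed
  show "s 0 m k = A (m + 1) - A m" "s 1 m k = B (k + 1) - B k"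
    using A[of m k] B[of k m] by simp_all
  show "s 2 m k = C (m + k + 1) - C (m + k)" using C[of "m + k" m] by simp
  show "s 3 m k = K (k - m - A m + 1) - K (k - m - A m)" using K[of "k - m - A m" m] by simp
  show e': "s 4 m k = K (k - m - A m) - B k + m" using e[of m "k - m - A m"] by simp
  show "s 5 m k = C (m + k) - A m - m - K (k - m - A m)" using c[of m k] e' by simp
qed

text \<open>For \<open>p = m * gold + \<rho>\<close> and \<open>q = k * gold + \<sigma>\<close> these are the entries at \<open>(m, k)\<close> of the array of
  \<open>A m = \<lfloor>m * gold + \<rho>\<rfloor>\<close>, \<open>B k = \<lfloor>k * gold + \<sigma>\<rfloor>\<close>, \<open>C l = \<lfloor>l * gold + \<rho> + \<sigma>\<rfloor>\<close> and
  \<open>K j = \<lfloor>j * gold + \<sigma> + gold * \<rho>\<rfloor>\<close>.\<close>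

definition state :: "nat \<Rightarrow> real \<Rightarrow> real \<Rightarrow> int" where
  "state i p q =
    (if i = 0 then \<lfloor>p + gold\<rfloor> - \<lfloor>p\<rfloor>
     else if i = 1 then \<lfloor>q + gold\<rfloor> - \<lfloor>q\<rfloor>
     else if i = 2 then \<lfloor>p + q + gold\<rfloor> - \<lfloor>p + q\<rfloor>
     else if i = 3 then \<lfloor>q + gold * frac p + gold\<rfloor> - \<lfloor>q + gold * frac p\<rfloor>
     else if i = 4 then \<lfloor>q + gold * frac p\<rfloor> - \<lfloor>q\<rfloor>
     else \<lfloor>p + q\<rfloor> - \<lfloor>p\<rfloor> - \<lfloor>q + gold * frac p\<rfloor>)"

lemma state_periodic1: "state i (p + of_int n) q = state i p q"
proof -
  have "frac (p + of_int n) = frac p" by (simp add: frac_def)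
  moreover have "p + of_int n + gold = p + gold + of_int n" "p + of_int n + q = p + q + of_int n"
    "p + of_int n + q + gold = p + q + gold + of_int n" by simp_all
  ultimately show ?thesis unfolding state_def by (simp only: floor_add_int) simp
qed

lemma state_periodic2: "state i p (q + of_int n) = state i p q"
proof -
  have "q + of_int n + gold = q + gold + of_int n" "p + (q + of_int n) = p + q + of_int n"
    "p + q + of_int n + gold = p + q + gold + of_int n"
    "q + of_int n + gold * frac p = q + gold * frac p + of_int n"
    "q + gold * frac p + of_int n + gold = q + gold * frac p + gold + of_int n" by simp_all
  then show ?thesis unfolding state_def by (simp only: floor_add_int) simp
qed

lemma floor_increment_bit: "0 \<le> t \<Longrightarrow> t \<le> 1 \<Longrightarrow> \<lfloor>x + t\<rfloor> - \<lfloor>x\<rfloor> \<in> {0, 1}" for x t :: real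
  by (cases "x + t < of_int \<lfloor>x\<rfloor> + 1") (auto; linarith)+

lemma frac_gold_bounds: "0 \<le> gold * frac p" "gold * frac p \<le> frac p" "gold * frac p \<le> 1"
proof -
  show 1: "0 \<le> gold * frac p" "gold * frac p \<le> frac p"
    using gold_pos gold_less_1 frac_ge_0[of p] by (auto intro: mult_left_le_one_le)
  then show "gold * frac p \<le> 1" using frac_lt_1[of p] by linarith
qed

lemma floor_add_frac: "\<lfloor>p + q\<rfloor> - \<lfloor>p\<rfloor> = \<lfloor>q + frac p\<rfloor>" for p q :: real
proof -
  have "q + frac p = p + q - of_int \<lfloor>p\<rfloor>" by (simp add: frac_def)
  then show ?thesis by (simp only: floor_diff_of_int)
qed

text \<open>Each entry is the increment of a floor under a translation of length in the unit
  interval: by \<open>gold\<close>, by \<open>gold * frac p\<close>, or for entry 5 by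
  \<open>(1 - gold) * frac p\<close>.\<close>

lemma state_bit: "state i p q \<in> {0, 1}"
proof -
  have g: "0 \<le> gold" "gold \<le> 1" using gold_pos gold_less_1 by simp_all
  note f = frac_gold_bounds[of p] frac_lt_1[of p]
  have "\<lfloor>q + gold * frac p + (frac p - gold * frac p)\<rfloor> - \<lfloor>q + gold * frac p\<rfloor> \<in> {0, 1}"
    by (rule floor_increment_bit) (use f in linarith)+
  then have "\<lfloor>p + q\<rfloor> - \<lfloor>p\<rfloor> - \<lfloor>q + gold * frac p\<rfloor> \<in> {0, 1}"
    by (simp add: floor_add_frac)
  then show ?thesis
    unfolding state_def
    using floor_increment_bit[OF g] floor_increment_bit[OF frac_gold_bounds(1,3)] by auto
qed

text \<open>Along the lines on which \<open>j\<close> is constant, \<open>q + gold * frac p\<close> moves by an integer.\<close>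

lemma state_line:
  assumes "a = state 0 p q"
  shows "q + of_int (1 + a) * gold + gold * frac (p + gold) = q + gold * frac p + 1"
proof -
  have "frac (p + gold) = frac p + gold - of_int a" by (simp add: frac_def assms state_def)
  then have "q + of_int (1 + a) * gold + gold * frac (p + gold) = q + gold * frac p + (gold + gold * gold)"
    unfolding \<open>frac (p + gold) = _\<close> by (simp add: algebra_simps)
  then show ?thesis by (simp add: gold_square)
qed

lemma floor_add_one_add: "\<lfloor>x + 1 + t\<rfloor> - \<lfloor>x + 1\<rfloor> = \<lfloor>x + t\<rfloor> - \<lfloor>x\<rfloor>" for x t :: real
proof -
  have "x + 1 + t = x + t + of_int 1" by simp
  then have "\<lfloor>x + 1 + t\<rfloor> = \<lfloor>x + t\<rfloor> + 1" by (simp only: floor_add_int)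
  then show ?thesis by simp
qed

lemma state_local_rule:
  "local_rule (\<lambda>i m k. state i (of_int m * gold + p) (of_int k * gold + q))"
proof -
  define a where "a = state 0 p q"
  have a: "a = 0 \<or> a = 1" using state_bit[of 0 p q] by (auto simp: a_def)
  note line = state_line[OF a_def]
  have line': "of_int (1 + a) * gold + q + gold * frac (gold + p) = q + gold * frac p + 1"
    using line by (simp only: ac_simps)
  \<comment> \<open>This is the site \<open>(1, 1 + a)\<close>, the next one on the line through the
    origin; \<open>a = 1\<close> and \<open>a = 0\<close> are the two branches of the rule.\<close>
  have 3: "state 3 (gold + p) (of_int (1 + a) * gold + q) = state 3 p q"
  proof -
    have "state 3 p q = \<lfloor>q + gold * frac p + gold\<rfloor> - \<lfloor>q + gold * frac p\<rfloor>" for p q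
      by (simp add: state_def)
    then show ?thesis by (simp only: line' floor_add_one_add)
  qed
  have 4: "state 4 (gold + p) (of_int (1 + a) * gold + q) = \<lfloor>q + gold * frac p\<rfloor> + 1 - \<lfloor>of_int (1 + a) * gold + q\<rfloor>"
  proof -
    have "state 4 p q = \<lfloor>q + gold * frac p\<rfloor> - \<lfloor>q\<rfloor>" for p q
      by (simp add: state_def)
    then show ?thesis by (simp only: line') linarith
  qed
  have 9: "state 4 p q + state 5 p q \<le> 1"
  proof -
    have "\<lfloor>q + frac p\<rfloor> - \<lfloor>q\<rfloor> \<in> {0, 1}"
      by (rule floor_increment_bit) (use frac_lt_1[of p] in auto)
    moreover have "state 4 p q + state 5 p q = \<lfloor>p + q\<rfloor> - \<lfloor>p\<rfloor> - \<lfloor>q\<rfloor>"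
      by (simp add: state_def)
    ultimately show ?thesis unfolding floor_add_frac[of p q] by auto
  qed
  show ?thesis
    unfolding local_rule_def
  proof (intro conjI)
    show "(if state 0 (of_int 0 * gold + p) (of_int 0 * gold + q) = 1
        then state 3 (of_int 1 * gold + p) (of_int 2 * gold + q)
        else state 3 (of_int 1 * gold + p) (of_int 1 * gold + q)) =
      state 3 (of_int 0 * gold + p) (of_int 0 * gold + q)"
      using 3 a by (auto simp: a_def[symmetric])
    show "if state 0 (of_int 0 * gold + p) (of_int 0 * gold + q) = 1
      then state 4 (of_int 1 * gold + p) (of_int 2 * gold + q) =
        state 4 (of_int 0 * gold + p) (of_int 0 * gold + q) + 1
        - state 1 (of_int 0 * gold + p) (of_int 0 * gold + q) - state 1 (of_int 0 * gold + p) (of_int 1 * gold + q)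
      else state 4 (of_int 1 * gold + p) (of_int 1 * gold + q) =
        state 4 (of_int 0 * gold + p) (of_int 0 * gold + q) + 1
        - state 1 (of_int 0 * gold + p) (of_int 0 * gold + q)"
      using 4 a by (auto simp: a_def[symmetric] state_def[of "Suc 0"] state_def[of 4 p q] algebra_simps)
    show "state 4 (of_int 0 * gold + p) (of_int 0 * gold + q) + state 5 (of_int 0 * gold + p) (of_int 0 * gold + q) \<le> 1"
      using 9 by simp
  qed (simp_all add: state_def algebra_simps)
qed

text \<open>The entries supply the conditions \<open>R1\<close>, \<open>R2\<close>,
  \<open>R3\<close> on the heights. The bounds on the deviations serve later to keep the suprema
  defining the phases finite.\<close>

lemma golden_array_phase:
  assumes s: "golden_array s"
  defines "\<rho> \<equiv> phase (height (\<lambda>m. s 0 m 0))" and "\<sigma> \<equiv> phase (height (\<lambda>k. s 1 0 k))"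
  shows "\<rho> \<in> {0..1}" and "\<sigma> \<in> {0..1}"
    and "\<And>m. of_int (height (\<lambda>m. s 0 m 0) m) - gold * of_int m \<in> {-1..1}"
    and "\<And>m. of_int (height (\<lambda>k. s 1 0 k) m) - gold * of_int m \<in> {-1..1}"
    and "gold_generic (\<rho>, \<sigma>) \<Longrightarrow> i < 6 \<Longrightarrow> s i m k = state i (of_int m * gold + \<rho>) (of_int k * gold + \<sigma>)"
proof -
  define A where "A = height (\<lambda>m. s 0 m 0)"
  define B where "B = height (\<lambda>k. s 1 0 k)"
  define C where "C = (\<lambda>l. s 4 0 0 + s 5 0 0 + height (\<lambda>l. s 2 0 l) l)"
  define K where "K = (\<lambda>j. s 4 0 0 + height (\<lambda>j. s 3 0 j) j)"
  have h: "s 0 m k = A (m + 1) - A m" "s 1 m k = B (k + 1) - B k"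
    "s 2 m k = C (m + k + 1) - C (m + k)"
    "s 3 m k = K (k - m - A m + 1) - K (k - m - A m)"
    "s 4 m k = K (k - m - A m) - B k + m"
    "s 5 m k = C (m + k) - A m - m - K (k - m - A m)" for m k
    unfolding A_def B_def C_def K_def by (fact golden_array_heights[OF s])+
  have bit: "s i m k \<in> {0, 1}" for i m k using s by (auto simp: golden_array_def)
  have le: "s 4 m k + s 5 m k \<le> 1" for m k
  proof -
    have "local_rule (\<lambda>i m' k'. s i (m + m') (k + k'))" using s by (simp add: golden_array_def)
    then show ?thesis by (auto simp: local_rule_def)
  qed
  have 0: "A 0 = 0" "B 0 = 0" by (simp_all add: A_def B_def)
  have inc: "A (m + 1) - A m \<in> {0, 1}" for m using h(1)[of m 0] bit[of 0 m 0] by auto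
  have R2: "K (k - m - A m) - B k + m \<in> {0, 1}" for m k using h(5)[of m k] bit[of 4 m k] by auto
  have R3: "C (m + k) - A m - m - K (k - m - A m) \<in> {0, 1}" for m k using h(6)[of m k] bit[of 5 m k] by auto
  have R1: "C (m + k) - A m - B k \<in> {0, 1}" for m k
    using h(5,6)[of m k] le[of m k] bit[of 4 m k] bit[of 5 m k] by auto
  note ph = golden_sequences_phase[OF 0 inc R1 R2, folded A_def B_def]
  have \<rho>: "\<rho> = phase A" and \<sigma>: "\<sigma> = phase B" by (simp_all add: \<rho>_def \<sigma>_def A_def B_def)
  show r: "\<rho> \<in> {0..1}" "\<sigma> \<in> {0..1}"
    using ph[of 0] 0 by (simp_all add: \<rho> \<sigma>)
  show "of_int (height (\<lambda>m. s 0 m 0) m) - gold * of_int m \<in> {-1..1}" for m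
    using ph(1,2)[of m] r unfolding A_def[symmetric] \<rho> by (simp add: algebra_simps)
  show "of_int (height (\<lambda>k. s 1 0 k) m) - gold * of_int m \<in> {-1..1}" for m
    using ph(3,4)[of m] r unfolding B_def[symmetric] \<sigma> by (simp add: algebra_simps)
  assume gen: "gold_generic (\<rho>, \<sigma>)" and i: "i < 6"
  define p where "p = of_int m * gold + \<rho>"
  define q where "q = of_int k * gold + \<sigma>"
  note F = golden_sequences_generic[OF 0 inc R1 R2 R3 gen[unfolded \<rho> \<sigma>], folded \<rho> \<sigma>]
  have Am: "A m = \<lfloor>p\<rfloor>" "A (m + 1) = \<lfloor>p + gold\<rfloor>" by (simp_all add: F(1) p_def algebra_simps)
  have Bk: "B k = \<lfloor>q\<rfloor>" "B (k + 1) = \<lfloor>q + gold\<rfloor>" by (simp_all add: F(2) q_def algebra_simps)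
  have Cl: "C (m + k) = \<lfloor>p + q\<rfloor>" "C (m + k + 1) = \<lfloor>p + q + gold\<rfloor>"
    by (simp_all add: F(3) p_def q_def algebra_simps)
  \<comment> \<open>Replacing \<open>A m\<close> by \<open>p - frac p\<close> turns the contribution
    of \<open>m\<close> into \<open>m * (gold + gold * gold) = m\<close>, an integer.\<close>
  have y: "of_int (k - m - A m) * gold + \<sigma> + gold * \<rho> = q + gold * frac p - of_int m"
  proof -
    have "q + gold * frac p = of_int (k - m - A m) * gold + \<sigma> + gold * \<rho> + of_int m * (gold + gold * gold)"
      by (simp add: q_def p_def frac_def F(1) algebra_simps)
    then show ?thesis by (simp add: gold_square)
  qed
  then have Kj: "K (k - m - A m) = \<lfloor>q + gold * frac p\<rfloor> - m" by (simp add: F(4))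
  have "of_int (k - m - A m + 1) * gold + \<sigma> + gold * \<rho> = q + gold * frac p + gold - of_int m"
    using y by (simp add: algebra_simps)
  then have Kj1: "K (k - m - A m + 1) = \<lfloor>q + gold * frac p + gold\<rfloor> - m"
    unfolding F(4) by (simp only: floor_diff_of_int)
  have "i = 0 \<or> i = 1 \<or> i = 2 \<or> i = 3 \<or> i = 4 \<or> i = 5" using i by linarith
  then have "s i m k = state i p q"
    using h[of m k, unfolded Kj Kj1] unfolding Am Bk Cl by (auto simp: state_def)
  then show "s i m k = state i (of_int m * gold + \<rho>) (of_int k * gold + \<sigma>)" by (simp add: p_def q_def)
qed


section \<open>Borel sets of configurations\<close>

lemma space_configuration_borel [simp]: "space configuration_borel = UNIV"
  by (simp add: configuration_borel_def)

lemma sets_configuration_coordinate: "{x :: ('d::finite, 'a) configuration. x v = s} \<in> sets configuration_borel"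
proof -
  have "continuous_map configuration_topology (discrete_topology UNIV) (\<lambda>x :: ('d, 'a) configuration. x v)"
    unfolding configuration_topology_def by (rule continuous_map_product_projection) simp
  then have "openin configuration_topology {x \<in> topspace configuration_topology. x v \<in> {s}}"
    by (rule openin_continuous_map_preimage) simp
  moreover have "topspace configuration_topology = (UNIV :: ('d, 'a) configuration set)"
    by (simp add: configuration_topology_def PiE_UNIV_domain)
  ultimately have "openin configuration_topology {x :: ('d, 'a) configuration. x v = s}" by simp
  then show ?thesis by (auto simp: configuration_borel_def)
qed

text \<open>There are only countably many finite patterns, so every open set is a countable union of
  cylinders, and each cylinder is a finite intersection of coordinate conditions.\<close>

lemma measurable_configuration:
  fixes f :: "'w \<Rightarrow> ('d::finite, 'a::finite) configuration"
  assumes f: "\<And>v s. {w \<in> space M. f w v = s} \<in> sets M"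
  shows "f \<in> measurable M configuration_borel"
  unfolding configuration_borel_def
proof (rule measurable_measure_of)
  fix U :: "('d, 'a) configuration set"
  assume "U \<in> {U. openin configuration_topology U}"
  then have U: "openin configuration_topology U" by simp
  define J where "J = (SIGMA E:{E :: (int ^ 'd) set. finite E}. E \<rightarrow>\<^sub>E (UNIV :: 'a set))"
  have J: "countable J"
    unfolding J_def by (intro countable_SIGMA countable_Collect_finite countable_finite finite_PiE) auto
  define J' where "J' = {(E, a) \<in> J. cylinder E a \<subseteq> U}"
  have "\<exists>E a. finite E \<and> a \<in> E \<rightarrow>\<^sub>E UNIV \<and> cylinder E a \<subseteq> U \<and> x \<in> cylinder E a" if "x \<in> U" for x
  proof -
    note * = bspec[OF iffD1[OF openin_product_topology_alt U[unfolded configuration_topology_def]] that]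
    obtain V where "finite {i \<in> UNIV. V i \<noteq> topspace (discrete_topology (UNIV :: 'a set))}"
      and V: "x \<in> Pi\<^sub>E UNIV V" "Pi\<^sub>E UNIV V \<subseteq> U"
      using * by (elim exE conjE) (rule that)
    then have fin: "finite {i. V i \<noteq> UNIV}" by simp
    define E where "E = {i. V i \<noteq> UNIV}"
    have "cylinder E (restrict x E) \<subseteq> Pi\<^sub>E UNIV V"
    proof
      fix y assume "y \<in> cylinder E (restrict x E)"
      then have eq: "restrict y E = restrict x E" by (simp add: cylinder_def)
      have "y v \<in> V v" for v
      proof (cases "v \<in> E")
        case True
        then have "y v = x v" using fun_cong[OF eq, of v] by simp
        then show ?thesis using PiE_mem[OF V(1), of v] by simp
      qed (simp add: E_def)
      then show "y \<in> Pi\<^sub>E UNIV V" by (simp add: PiE_UNIV_domain)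
    qed
    with V(2) have "cylinder E (restrict x E) \<subseteq> U" by blast
    then show ?thesis using fin
      by (intro exI[of _ E] exI[of _ "restrict x E"]) (auto simp: E_def cylinder_def)
  qed
  then have Ueq: "U = (\<Union>(E, a)\<in>J'. cylinder E a)"
    by (fastforce simp: J'_def J_def)
  have "f -` cylinder (fst p) (snd p) \<inter> space M \<in> sets M" if "p \<in> J'" for p
  proof -
    have p: "finite (fst p)" "snd p \<in> fst p \<rightarrow>\<^sub>E UNIV" using that by (auto simp: J'_def J_def)
    have "f -` cylinder (fst p) (snd p) \<inter> space M = {w \<in> space M. \<forall>v\<in>fst p. f w v = snd p v}"
      using p(2) by (auto simp: cylinder_def fun_eq_iff PiE_def extensional_def restrict_def)
    also have "\<dots> \<in> sets M" using p(1) f by (intro sets.sets_Collect_finite_All) auto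
    finally show ?thesis .
  qed
  moreover have "countable J'" by (rule countable_subset[OF _ J]) (auto simp: J'_def)
  ultimately have "(\<Union>p\<in>J'. f -` cylinder (fst p) (snd p) \<inter> space M) \<in> sets M"
    by (intro sets.countable_UN'') auto
  also have "(\<Union>p\<in>J'. f -` cylinder (fst p) (snd p) \<inter> space M) = f -` U \<inter> space M"
    by (subst Ueq) (auto simp: case_prod_unfold)
  finally show "f -` U \<inter> space M \<in> sets M" .
qed auto

lemma measurable_shift [measurable]:
  "shift u \<in> measurable (configuration_borel :: ('d::finite, 'a::finite) configuration measure) configuration_borel"
  by (rule measurable_configuration) (simp add: shift_def sets_configuration_coordinate)

lemma sets_configuration_pattern:
  fixes P :: "('d::finite, 'a::finite) configuration \<Rightarrow> bool"
  assumes "finite E"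
  shows "{x. P (restrict x E)} \<in> sets configuration_borel"
proof -
  have cyl: "cylinder E a \<in> sets configuration_borel" if "a \<in> E \<rightarrow>\<^sub>E UNIV" for a :: "('d, 'a) configuration"
  proof -
    have "cylinder E a = {x \<in> space configuration_borel. \<forall>v\<in>E. x v = a v}"
      using that by (auto simp: cylinder_def fun_eq_iff PiE_def extensional_def restrict_def)
    also have "\<dots> \<in> sets configuration_borel"
      using assms by (intro sets.sets_Collect_finite_All) (auto simp: sets_configuration_coordinate)
    finally show ?thesis .
  qed
  have "{x. P (restrict x E)} = (\<Union>a\<in>{a \<in> E \<rightarrow>\<^sub>E UNIV. P a}. cylinder E a)"
    by (auto simp: cylinder_def)
  also have "\<dots> \<in> sets configuration_borel"
    using assms cyl by (intro sets.finite_UN finite_subset[OF _ finite_PiE]) auto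
  finally show ?thesis .
qed

lemma finite_box: "finite (box n :: (int ^ 'd::finite) set)"
proof -
  have "finite (vec_nth ` (box n :: (int ^ 'd) set))"
    by (rule finite_subset[of _ "UNIV \<rightarrow>\<^sub>E {- int n..int n}"]) (auto simp: box_def intro: finite_PiE)
  then show ?thesis by (rule finite_imageD) (simp add: inj_on_def vec_eq_iff)
qed

lemma shift_shift: "shift u (shift v x) = shift (v + u) x"
  by (simp add: shift_def add.assoc)

lemma shift_0 [simp]: "shift 0 x = x"
  by (simp add: shift_def)

text \<open>The forbidden patterns are those on the window that violate \<open>P\<close>.\<close>

lemma sft_of_rule:
  fixes P :: "('d::finite, 'a::finite) configuration \<Rightarrow> bool" and n :: nat
  defines "X \<equiv> {x. \<forall>u. P (restrict (shift u x) (box n))}"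
  shows "shift_of_finite_type X" and "X \<in> sets configuration_borel"
proof -
  have "X = SFT n {p \<in> box n \<rightarrow>\<^sub>E UNIV. \<not> P p}" by (auto simp: X_def SFT_def)
  then show "shift_of_finite_type X"
    unfolding shift_of_finite_type_def by (intro exI[of _ n] exI conjI) auto
  have *: "{x. P (restrict (shift u x) (box n))} \<in> sets configuration_borel" for u
  proof -
    have "shift u -` {x. P (restrict x (box n))} \<inter> space configuration_borel \<in> sets configuration_borel"
      by (rule measurable_sets[OF measurable_shift]) (rule sets_configuration_pattern[OF finite_box])
    then show ?thesis by (simp add: vimage_def)
  qed
  have "X = (\<Inter>u. {x. P (restrict (shift u x) (box n))})" by (auto simp: X_def)
  also have "\<dots> \<in> sets configuration_borel"
    using * sets.top[of "configuration_borel :: ('d, 'a) configuration measure"]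
    by (intro sets.countable_INT'') simp_all
  finally show "X \<in> sets configuration_borel" .
qed


section \<open>A binary coding\<close>

text \<open>The construction takes place in one coordinate plane and with two letters, whatever the
  dimension and the alphabet.\<close>

locale binary_coding =
  fixes i1 i2 :: "'d::finite" and s0 s1 :: "'a::finite"
  assumes i12: "i1 \<noteq> i2" and s01: "s0 \<noteq> s1"
begin

definition pt :: "int \<Rightarrow> int \<Rightarrow> int ^ 'd" where
  "pt i k = (\<chi> j. if j = i1 then i else if j = i2 then k else 0)"

lemma pt_nth [simp]: "pt i k $ i1 = i" "pt i k $ i2 = k"
  using i12 by (simp_all add: pt_def)

lemma pt_add: "pt i k + pt i' k' = pt (i + i') (k + k')"
  by (simp add: pt_def vec_eq_iff)

lemma pt_0: "pt 0 0 = 0"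
  by (simp add: pt_def vec_eq_iff)

lemma pt_in_box: "\<bar>i\<bar> \<le> int n \<Longrightarrow> \<bar>k\<bar> \<le> int n \<Longrightarrow> pt i k \<in> box n"
  by (auto simp: pt_def box_def)

lemma shift_pt [simp]: "shift (pt i k) x (pt i' k') = x (pt (i + i') (k + k'))"
  by (simp add: shift_def pt_add)

text \<open>The entries of the array at \<open>(m, k)\<close> are written in row \<open>k\<close>, from position \<open>15 * m\<close> on, as the word
  \<open>1 1 0 b\<^sub>0 0 b\<^sub>1 0 b\<^sub>2 0 b\<^sub>3 0 b\<^sub>4 0 b\<^sub>5 0\<close>, in which \<open>1 1\<close> occurs only at the beginning.\<close>

definition bit :: "('d, 'a) configuration \<Rightarrow> nat \<Rightarrow> int \<Rightarrow> int \<Rightarrow> int" where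
  "bit x t m k = (if x (pt (15 * m + 3 + 2 * int t) k) = s1 then 1 else 0)"

definition sync :: "('d, 'a) configuration \<Rightarrow> bool" where
  "sync x \<longleftrightarrow> x (pt 0 0) = s1 \<and> x (pt 1 0) = s1"

text \<open>Together with the word, the clauses on \<open>sync\<close> confine block beginnings to
  one class modulo 15, common to all rows; the array rule is tested only there. The last clause
  makes configurations constant in the remaining directions, which reduces dimension
  \<open>d\<close> to 2.\<close>

definition coding_rule :: "('d, 'a) configuration \<Rightarrow> bool" where
  "coding_rule x \<longleftrightarrow>
     (\<exists>i\<in>{-14..0}. sync (shift (pt i 0) x)) \<and>
     sync (shift (pt 15 0) x) = sync x \<and> sync (shift (pt 0 1) x) = sync x \<and>
     (sync x \<longrightarrow> (\<forall>j\<in>{1..7}. x (pt (2 * j) 0) = s0) \<and> local_rule (bit x)) \<and>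
     x (pt 0 0) \<in> {s0, s1} \<and> (\<forall>i. i \<noteq> i1 \<longrightarrow> i \<noteq> i2 \<longrightarrow> x (axis i 1) = x (pt 0 0))"

text \<open>The radius 30 suffices since the farthest site read is 28 away, namely
  \<open>b\<^sub>5\<close> of the next block at \<open>15 + 3 + 2 * 5\<close>.\<close>

definition X :: "('d, 'a) configuration set" where
  "X = {x. \<forall>u. coding_rule (restrict (shift u x) (box 30))}"

lemma coding_rule_restrict: "coding_rule (restrict x (box 30)) = coding_rule x"
proof -
  have [simp]: "pt i k \<in> box 30" if "\<bar>i\<bar> \<le> 30" "\<bar>k\<bar> \<le> 30" for i k
    using pt_in_box[of i 30 k] that by simp
  have [simp]: "axis i 1 \<in> box 30" for i :: 'd
    by (simp add: box_def axis_def)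
  have sync [simp]: "sync (shift (pt i k) (restrict x (box 30))) = sync (shift (pt i k) x)"
    if "-20 \<le> i" "i \<le> 20" "-20 \<le> k" "k \<le> 20" for i k
    using that by (simp add: sync_def)
  have "sync (restrict x (box 30)) = sync x" by (simp add: sync_def)
  moreover have "local_rule (bit (restrict x (box 30))) = local_rule (bit x)"
    by (simp add: local_rule_def bit_def)
  moreover have "(\<exists>i\<in>{-14..0}. sync (shift (pt i 0) (restrict x (box 30)))) = (\<exists>i\<in>{-14..0}. sync (shift (pt i 0) x))"
    by (intro bex_cong) auto
  moreover have "(\<forall>j\<in>{1..7}. restrict x (box 30) (pt (2 * j) 0) = s0) = (\<forall>j\<in>{1..7}. x (pt (2 * j) 0) = s0)"
    by (intro ball_cong) auto
  ultimately show ?thesis by (simp add: coding_rule_def)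
qed

lemma X_iff: "x \<in> X \<longleftrightarrow> (\<forall>u. coding_rule (shift u x))"
  by (simp add: X_def coding_rule_restrict)

lemma sft_X: "shift_of_finite_type X" and sets_X [measurable]: "X \<in> sets configuration_borel"
  unfolding X_def by (rule sft_of_rule)+

lemma shift_X [simp]: "shift u x \<in> X \<longleftrightarrow> x \<in> X"
proof -
  have 1: "shift u x \<in> X" if "x \<in> X" for u x
    using that by (simp add: X_iff shift_shift)
  show ?thesis using 1[of x u] 1[of "shift u x" "- u"] by (auto simp: shift_shift)
qed

text \<open>A cross section: the moves by whole blocks and rows preserve it, and fifteen horizontal
  translates of it partition \<open>X\<close>.\<close>

definition E :: "('d, 'a) configuration set" where
  "E = {x \<in> X. sync x}"

lemma sets_E [measurable]: "E \<in> sets configuration_borel"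
proof -
  have "E = X \<inter> {x. x (pt 0 0) = s1} \<inter> {x. x (pt 1 0) = s1}" by (auto simp: E_def sync_def)
  then show ?thesis by (simp only: sets.Int sets_X sets_configuration_coordinate)
qed

lemma X_rule: "x \<in> X \<Longrightarrow> coding_rule (shift u x)"
  by (simp add: X_iff)

lemma shift_E [simp]: "shift (pt (15 * m) k) x \<in> E \<longleftrightarrow> x \<in> E"
proof (cases "x \<in> X")
  case True
  have r: "sync (shift (pt (15 * m) k) x) = sync (shift (pt (15 * m) 0) x)" for m
  proof (rule trans[OF int_step_constant[where f="\<lambda>k. sync (shift (pt (15 * m) k) x)"]])
    show "sync (shift (pt (15 * m) (k + 1)) x) = sync (shift (pt (15 * m) k) x)" for k
      using X_rule[OF True, of "pt (15 * m) k"] by (simp add: coding_rule_def shift_shift pt_add)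
  qed simp
  have "sync (shift (pt (15 * m) 0) x) = sync (shift (pt (15 * 0) 0) x)"
  proof (rule int_step_constant[where f="\<lambda>m. sync (shift (pt (15 * m) 0) x)"])
    show "sync (shift (pt (15 * (m + 1)) 0) x) = sync (shift (pt (15 * m) 0) x)" for m
      using X_rule[OF True, of "pt (15 * m) 0"]
      by (simp add: coding_rule_def shift_shift pt_add algebra_simps)
  qed
  then show ?thesis using r[of m] by (simp add: E_def pt_0)
qed (simp add: E_def)

lemma E_word:
  assumes "x \<in> E"
  shows "x (pt (15 * m) k) = s1" "x (pt (15 * m + 1) k) = s1"
    and "1 \<le> j \<Longrightarrow> j \<le> 7 \<Longrightarrow> x (pt (15 * m + 2 * j) k) = s0"
    and "golden_array (bit x)"
proof -
  have sync: "sync (shift (pt (15 * m) k) x)" for m k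
    using assms shift_E[of m k x] by (simp add: E_def)
  have rule: "coding_rule (shift (pt (15 * m) k) x)" for m k
    using assms by (simp add: E_def X_rule)
  show "x (pt (15 * m) k) = s1" "x (pt (15 * m + 1) k) = s1"
    using sync[of m k] by (simp_all add: sync_def)
  show "x (pt (15 * m + 2 * j) k) = s0" if "1 \<le> j" "j \<le> 7"
    using sync[of m k] rule[of m k] that by (simp add: coding_rule_def)
  have "bit (shift (pt (15 * m) k) x) = (\<lambda>i m' k'. bit x i (m + m') (k + k'))" for m k
    by (simp add: bit_def fun_eq_iff algebra_simps)
  then have "local_rule (\<lambda>i m' k'. bit x i (m + m') (k + k'))" for m k
    using sync[of m k] rule[of m k] unfolding coding_rule_def by metis
  then show "golden_array (bit x)" unfolding golden_array_def by (auto simp: bit_def)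
qed

lemma X_planar:
  assumes "x \<in> X"
  shows "x v = x (pt (v $ i1) (v $ i2))"
proof -
  have *: "x (u + axis i 1) = x u" if "i \<noteq> i1" "i \<noteq> i2" for u i
    using X_rule[OF assms, of u] that by (simp add: coding_rule_def pt_0) (simp add: shift_def)
  have line: "x (u + axis i n) = x u" if "i \<noteq> i1" "i \<noteq> i2" for u i n
  proof -
    have "x (u + axis i n) = x (u + axis i 0)"
    proof (rule int_step_constant[where f="\<lambda>n. x (u + axis i n)"])
      show "x (u + axis i (n + 1)) = x (u + axis i n)" for n
      proof -
        have eq: "u + axis i (n + 1) = u + axis i n + axis i 1" by (simp add: vec_eq_iff axis_def)
        show ?thesis unfolding eq by (rule *[OF that])
      qed
    qed
    then show ?thesis by (simp add: axis_def zero_vec_def[symmetric])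
  qed
  \<comment> \<open>The coordinates outside the plane are set to 0 one at a time.\<close>
  have "x (\<chi> j. if j \<in> J then 0 else v $ j) = x v" if "finite J" "J \<subseteq> - {i1, i2}" for J
    using that
  proof (induction J rule: finite_induct)
    case empty
    then show ?case by (simp add: vec_nth_inverse)
  next
    case (insert i J)
    have "(\<chi> j. if j \<in> insert i J then 0 else v $ j) = (\<chi> j. if j \<in> J then 0 else v $ j) + axis i (- v $ i)"
      using insert.hyps by (auto simp: vec_eq_iff axis_def)
    then show ?case using insert line[of i "\<chi> j. if j \<in> J then 0 else v $ j" "- v $ i"] by simp
  qed
  from this[of "- {i1, i2}"] have "x (\<chi> j. if j \<in> - {i1, i2} then 0 else v $ j) = x v" by simp
  moreover have "(\<chi> j. if j \<in> - {i1, i2} then 0 else v $ j) = pt (v $ i1) (v $ i2)"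
    by (auto simp: pt_def vec_eq_iff)
  ultimately show ?thesis by simp
qed

section \<open>Configurations coded from points of the torus\<close>

definition code :: "real \<times> real \<Rightarrow> ('d, 'a) configuration" where
  "code t v = (let r = v $ i1 mod 15 in
     if r = 0 \<or> r = 1 then s1 else if even r then s0
     else if state (nat ((r - 3) div 2)) (of_int (v $ i1 div 15) * gold + fst t) (of_int (v $ i2) * gold + snd t) = 1
       then s1 else s0)"

lemma residue_cases:
  fixes r :: int
  assumes "0 \<le> r" "r < 15"
  obtains "r = 0" | "r = 1" | j where "1 \<le> j" "j \<le> 7" "r = 2 * j" | t where "t < 6" "r = 3 + 2 * int t"
proof -
  consider "r = 0" | "r = 1" | "r \<ge> 2" "even r" | "r \<ge> 2" "odd r" using assms by linarith
  then show ?thesis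
  proof cases
    case 3
    then obtain j where "r = 2 * j" by blast
    then show ?thesis using 3 assms that(3)[of j] by simp
  next
    case 4
    then obtain j where "r = 2 * j + 1" by (elim oddE)
    then show ?thesis using 4 assms that(4)[of "nat (j - 1)"] by simp
  qed (use that in blast)+
qed

definition \<rho> :: "('d, 'a) configuration \<Rightarrow> real" where
  "\<rho> x = phase (height (\<lambda>m. bit x 0 m 0))"

definition \<sigma> :: "('d, 'a) configuration \<Rightarrow> real" where
  "\<sigma> x = phase (height (\<lambda>k. bit x 1 0 k))"

lemma E_generic:
  assumes "x \<in> E" and gen: "gold_generic (\<rho> x, \<sigma> x)"
  shows "x = code (\<rho> x, \<sigma> x)"
proof
  fix v :: "int ^ 'd"
  define m where "m = v $ i1 div 15"
  define r where "r = v $ i1 mod 15"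
  have v: "v $ i1 = 15 * m + r" by (simp add: m_def r_def)
  have xX: "x \<in> X" using assms by (simp add: E_def)
  have "0 \<le> r" "r < 15" by (simp_all add: r_def)
  then have "x (pt (15 * m + r) (v $ i2)) = code (\<rho> x, \<sigma> x) v"
  proof (cases rule: residue_cases)
    case 1
    then show ?thesis using E_word(1)[OF assms(1)] by (simp add: code_def r_def[symmetric])
  next
    case 2
    then show ?thesis using E_word(2)[OF assms(1)] by (simp add: code_def r_def[symmetric])
  next
    case (3 j)
    then show ?thesis using E_word(3)[OF assms(1), of j m] by (simp add: code_def r_def[symmetric])
  next
    case (4 t)
    have "bit x t m (v $ i2) = state t (of_int m * gold + \<rho> x) (of_int (v $ i2) * gold + \<sigma> x)"
      unfolding \<rho>_def \<sigma>_def using gen 4(1)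
      by (intro golden_array_phase(5)[OF E_word(4)[OF assms(1)]]) (simp_all add: \<rho>_def \<sigma>_def)
    \<comment> \<open>\<open>bit\<close> only tests for \<open>s1\<close>; the restriction to two
      letters makes a zero bit mean \<open>s0\<close>.\<close>
    moreover have "x (pt (15 * m + 3 + 2 * int t) (v $ i2)) \<in> {s0, s1}"
      using X_rule[OF xX, of "pt (15 * m + 3 + 2 * int t) (v $ i2)"] by (simp add: coding_rule_def)
    ultimately show ?thesis
      using 4 by (auto simp: code_def r_def[symmetric] m_def[symmetric] bit_def add.assoc split: if_splits)
  qed
  then show "x v = code (\<rho> x, \<sigma> x) v" using X_planar[OF xX, of v] by (simp add: v)
qed

lemma code_s1: "v $ i1 mod 15 = 0 \<or> v $ i1 mod 15 = 1 \<Longrightarrow> code t v = s1"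
  by (auto simp: code_def)

lemma code_s0: "even (v $ i1 mod 15) \<Longrightarrow> v $ i1 mod 15 \<noteq> 0 \<Longrightarrow> code t v = s0"
  unfolding code_def Let_def by (metis odd_one)

text \<open>Self-synchronization: unless the residue is 0, the site or its right neighbour has an
  even nonzero residue and carries \<open>s0\<close>. The last residue 14 is even, so block
  boundaries create no further pair.\<close>

lemma code_sync: "sync (shift u (code t)) \<longleftrightarrow> u $ i1 mod 15 = 0"
proof -
  have sync: "sync (shift u (code t)) \<longleftrightarrow> code t u = s1 \<and> code t (u + pt 1 0) = s1"
    by (simp add: sync_def shift_def pt_0)
  have nth: "(u + pt 1 0) $ i1 = u $ i1 + 1" by simp
  consider "u $ i1 mod 15 = 0" | "even (u $ i1 mod 15)" "u $ i1 mod 15 \<noteq> 0" | "odd (u $ i1 mod 15)" by blast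
  then show ?thesis
  proof cases
    case 1
    then have "(u $ i1 + 1) mod 15 = 1" by presburger
    then show ?thesis using 1 code_s1[of u] code_s1[of "u + pt 1 0"] by (simp add: sync)
  next
    case 2
    then show ?thesis using code_s0[of u] s01 by (simp add: sync)
  next
    case 3
    define r where "r = u $ i1 mod 15"
    have r: "0 \<le> r" "r < 15" "odd r" using 3 by (simp_all add: r_def)
    then have "r \<noteq> 14" by auto
    with r have "r + 1 < 15" by linarith
    moreover have "(u $ i1 + 1) mod 15 = (r + 1) mod 15" by (simp add: r_def mod_add_left_eq)
    ultimately have "(u $ i1 + 1) mod 15 = r + 1" using r by simp
    then have "even ((u $ i1 + 1) mod 15)" "(u $ i1 + 1) mod 15 \<noteq> 0" "u $ i1 mod 15 \<noteq> 0"
      using r by (auto simp: r_def[symmetric])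
    then show ?thesis using code_s0[of "u + pt 1 0"] s01 unfolding sync nth by metis
  qed
qed

lemma code_periodic: "code (p + of_int m, q + of_int n) = code (p, q)"
proof -
  have "of_int a * gold + (p + of_int m) = (of_int a * gold + p) + of_int m"
    "of_int b * gold + (q + of_int n) = (of_int b * gold + q) + of_int n" for a b :: int by simp_all
  then show ?thesis unfolding code_def fst_conv snd_conv by (simp only: state_periodic1 state_periodic2)
qed

lemma code_frac: "code (frac p, frac q) = code (p, q)"
  using code_periodic[of p "- \<lfloor>p\<rfloor>" q "- \<lfloor>q\<rfloor>"] by (simp add: frac_def)

text \<open>The block whose beginning becomes the new origin is free: \<open>m\<close> is chosen so
  that the remaining horizontal shift is 0, or a residue modulo 15.\<close>

lemma code_shift:
  "shift v (code (p, q)) =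
    shift (pt (v $ i1 - 15 * m) 0) (code (p + of_int m * gold, q + of_int (v $ i2) * gold))"
proof
  fix w :: "int ^ 'd"
  have eq: "v $ i1 - 15 * m + w $ i1 = v $ i1 + w $ i1 + 15 * (- m)" by simp
  have "(v $ i1 - 15 * m + w $ i1) mod 15 = (v $ i1 + w $ i1) mod 15"
    unfolding eq by (rule mod_mult_self2)
  moreover have "(v $ i1 - 15 * m + w $ i1) div 15 = (v $ i1 + w $ i1) div 15 - m"
    unfolding eq by (subst div_mult_self2) simp_all
  moreover have "of_int (a - m) * gold + (p + of_int m * gold) = of_int a * gold + p"
    "of_int (0 + w $ i2) * gold + (q + of_int (v $ i2) * gold) = of_int (v $ i2 + w $ i2) * gold + q" for a :: int
    by (simp_all add: algebra_simps)
  ultimately show "shift v (code (p, q)) w =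
      shift (pt (v $ i1 - 15 * m) 0) (code (p + of_int m * gold, q + of_int (v $ i2) * gold)) w"
    by (simp only: shift_def code_def vector_add_component pt_nth fst_conv snd_conv)
qed

lemma local_rule_cong:
  assumes "\<And>i m k. i < 6 \<Longrightarrow> s i m k = s' i m k"
  shows "local_rule s = local_rule s'"
  by (simp add: local_rule_def assms)

lemma code_bit:
  assumes "i < 6"
  shows "bit (code t) i m k = state i (of_int m * gold + fst t) (of_int k * gold + snd t)"
proof -
  have eq: "15 * m + 3 + 2 * int i = 3 + 2 * int i + 15 * m" by simp
  have "(15 * m + 3 + 2 * int i) mod 15 = 3 + 2 * int i" "(15 * m + 3 + 2 * int i) div 15 = m"
    unfolding eq using assms by simp_all
  then show ?thesis
    using assms state_bit[of i "of_int m * gold + fst t" "of_int k * gold + snd t"] s01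
    by (auto simp: bit_def code_def)
qed

lemma code_rule: "coding_rule (shift u (code t))"
proof -
  have code_u: "shift u (code t) v \<in> {s0, s1}" for v
    by (simp add: shift_def code_def Let_def)
  have ax: "shift u (code t) (axis i 1) = shift u (code t) (pt 0 0)" if "i \<noteq> i1" "i \<noteq> i2" for i
    using that by (simp add: shift_def code_def axis_def Let_def)
  have ex: "\<exists>i\<in>{-14..0}. sync (shift (pt i 0) (shift u (code t)))"
    \<comment> \<open>The witness steps back to the beginning of the current block.\<close>
    by (rule bexI[of _ "- (u $ i1 mod 15)"]) (auto simp: shift_shift code_sync minus_mod_eq_mult_div algebra_simps)
  have word: "(\<forall>j\<in>{1..7}. shift u (code t) (pt (2 * j) 0) = s0) \<and> local_rule (bit (shift u (code t)))"
    if "sync (shift u (code t))"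
  proof -
    from that obtain m where m: "u $ i1 = 15 * m" by (auto simp: code_sync)
    have eq: "shift u (code t) = code (fst t + of_int m * gold, snd t + of_int (u $ i2) * gold)"
      using code_shift[of u "fst t" "snd t" m] by (simp add: m pt_0)
    have "shift u (code t) (pt (2 * j) 0) = s0" if "j \<in> {1..7}" for j
    proof -
      have "2 * j mod 15 = 2 * j" "2 * j \<noteq> 0" "2 * j \<noteq> 1" using that by auto
      then show ?thesis unfolding eq by (simp add: code_def)
    qed
    moreover have "local_rule (bit (shift u (code t)))"
      unfolding eq by (subst local_rule_cong[OF code_bit]) (auto intro: state_local_rule)
    ultimately show ?thesis by blast
  qed
  show ?thesis
    unfolding coding_rule_def
    using ex word code_u[of "pt 0 0"] ax by (auto simp: shift_shift code_sync)
qed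

lemma code_in_X: "shift u (code t) \<in> X"
  by (simp add: X_iff shift_shift code_rule)

end


section \<open>Phases and invariant measures\<close>

text \<open>Moving the origin by one site reindexes the supremum and subtracts \<open>f 0\<close>
  from the heights, so modulo 1 the phase is rotated by \<open>gold\<close>.\<close>

lemma phase_shift:
  assumes "\<And>m. of_int (height f m) - gold * of_int m \<in> {-1..1}"
  shows "phase (height (\<lambda>m. f (m + 1))) = phase (height f) + gold - of_int (f 0)"
proof -
  define g where "g m = of_int (height f m) - gold * of_int m" for m
  have "height (\<lambda>m. f (m + 1)) m - height f (m + 1) = height (\<lambda>m. f (m + 1)) 0 - height f (0 + 1)" for m
    by (rule int_step_constant[where f="\<lambda>m. height (\<lambda>m. f (m + 1)) m - height f (m + 1)"])
      (simp only: height_step)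
  then have h: "height (\<lambda>m. f (m + 1)) m = height f (m + 1) - f 0" for m
    by (simp add: height_step[of f 0, simplified] algebra_simps)
  have bdd: "bdd_above (range g)" using assms by (intro bdd_aboveI2[where M=1]) (simp add: g_def)
  define g' where "g' m = of_int (height (\<lambda>m. f (m + 1)) m) - gold * of_int m" for m
  have g': "g' m = g (m + 1) + gold - of_int (f 0)" for m
    by (simp add: g'_def g_def h algebra_simps)
  have up: "g' m \<le> (SUP m. g m) + gold - of_int (f 0)" for m
    using cSUP_upper[OF UNIV_I bdd, of "m + 1"] by (simp add: g')
  then have bdd': "bdd_above (range g')" by (intro bdd_aboveI2)
  have "(SUP m. g' m) = (SUP m. g m) + gold - of_int (f 0)"
  proof (rule antisym)
    show "(SUP m. g' m) \<le> (SUP m. g m) + gold - of_int (f 0)"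
      using up by (intro cSUP_least) auto
    have "(SUP m. g m) \<le> (SUP m. g' m) - gold + of_int (f 0)"
    proof (intro cSUP_least)
      show "g m \<le> (SUP m. g' m) - gold + of_int (f 0)" for m
        using cSUP_upper[OF UNIV_I bdd', of "m - 1"] g'[of "m - 1"] by simp
    qed simp
    then show "(SUP m. g m) + gold - of_int (f 0) \<le> (SUP m. g' m)" by simp
  qed
  then show ?thesis by (simp add: phase_def g_def g'_def)
qed

lemma emeasure_unif2_UNIV: "emeasure (unif \<Otimes>\<^sub>M unif) UNIV = 1"
  using unif2.emeasure_space_1 by (simp add: space_pair_measure)

lemma AE_unif_countable: "countable D \<Longrightarrow> AE p in unif. p \<notin> D"
proof (rule AE_I'[of D])
  assume D: "countable D"
  then have "D \<in> sets borel" by (intro sets.countable[OF _ D]) simp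
  then show "D \<in> null_sets unif" using emeasure_unif_countable[OF D] by (auto simp: null_sets_def)
qed auto

lemma AE_gold_generic: "AE t in unif \<Otimes>\<^sub>M unif. gold_generic t"
proof (rule unif2.AE_pair_measure)
  show "{t \<in> space (unif \<Otimes>\<^sub>M unif). gold_generic t} \<in> sets (unif \<Otimes>\<^sub>M unif)"
    unfolding gold_generic_def by measurable
  \<comment> \<open>\<open>D c\<close> collects the values whose sum with \<open>c\<close> and some
    multiple of \<open>gold\<close> is an integer; for fixed \<open>p\<close> only countably many
    \<open>q\<close> are excluded.\<close>
  define D where "D c = range (\<lambda>(m, n). of_int n - of_int m * gold - c :: real)" for c :: real
  have D: "countable (D c)" for c by (simp add: D_def)
  have in_D: "p \<in> D c" if "of_int m * gold + c + p = of_int n" for p c m n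
    using that by (auto simp: D_def intro!: image_eqI[of _ _ "(m, n)"])
  show "AE p in unif. AE q in unif. gold_generic (p, q)"
    using AE_unif_countable[OF D[of 0]]
  proof eventually_elim
    case (elim p)
    show "AE q in unif. gold_generic (p, q)"
      using AE_unif_countable[OF D[of 0]] AE_unif_countable[OF D[of p]] AE_unif_countable[OF D[of "gold * p"]]
    proof eventually_elim
      case (elim q)
      show ?case
        unfolding gold_generic_def fst_conv snd_conv
        using \<open>p \<notin> D 0\<close> elim in_D[of _ 0 p] in_D[of _ 0 q] in_D[of _ p q] in_D[of _ "gold * p" q]
        by (simp add: ac_simps) blast
    qed
  qed
qed

context binary_coding
begin

lemma measurable_code [measurable]: "code \<in> measurable (borel \<Otimes>\<^sub>M borel) configuration_borel"
proof (rule measurable_configuration)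
  fix v :: "int ^ 'd" and s :: 'a
  have "Measurable.pred (borel \<Otimes>\<^sub>M borel) (\<lambda>t. code t v = s)"
    unfolding code_def Let_def state_def by measurable
  then show "{t \<in> space (borel \<Otimes>\<^sub>M borel). code t v = s} \<in> sets (borel \<Otimes>\<^sub>M borel)"
    by (rule predE)
qed

section \<open>The phases as a map to the torus\<close>

lemma E_phase:
  assumes "x \<in> E"
  shows "\<rho> x \<in> {0..1}" and "\<sigma> x \<in> {0..1}"
    and "\<And>m. of_int (height (\<lambda>m. bit x 0 m 0) m) - gold * of_int m \<in> {-1..1}"
    and "\<And>m. of_int (height (\<lambda>k. bit x 1 0 k) m) - gold * of_int m \<in> {-1..1}"
  unfolding \<rho>_def \<sigma>_def by (rule golden_array_phase[OF E_word(4)[OF assms]])+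

lemma measurable_phase:
  fixes f :: "('d, 'a) configuration \<Rightarrow> int \<Rightarrow> int"
  assumes f [measurable]: "\<And>i. (\<lambda>x. real_of_int (f x i)) \<in> borel_measurable configuration_borel"
    and bound: "\<And>x m. x \<in> E \<Longrightarrow> of_int (height (f x) m) - gold * of_int m \<in> {-1..1}"
  shows "(\<lambda>x. if x \<in> E then phase (height (f x)) else 0) \<in> borel_measurable configuration_borel"
proof -
  \<comment> \<open>The value 0 outside \<open>E\<close> keeps the supremum over the countable index
    set bounded at every configuration.\<close>
  define F where "F m x = (if x \<in> E then of_int (height (f x) m) - gold * of_int m else 0 :: real)" for m x
  have [measurable]: "F m \<in> borel_measurable configuration_borel" for m
    unfolding F_def height_def of_int_diff of_int_sum by measurable
  have "(\<lambda>x. SUP m. F m x) \<in> borel_measurable configuration_borel"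
  proof (rule borel_measurable_cSUP)
    show "bdd_above (range (\<lambda>m. F m x))" for x
      using bound[of x] by (intro bdd_aboveI2[where M=1]) (auto simp: F_def)
  qed auto
  also have "(\<lambda>x. SUP m. F m x) = (\<lambda>x. if x \<in> E then phase (height (f x)) else 0)"
    by (auto simp: F_def phase_def)
  finally show ?thesis .
qed

text \<open>Phases lie in the closed unit interval, and \<open>frac\<close> identifies its ends; the
  default 0 makes the map measurable on all configurations.\<close>

definition torus :: "('d, 'a) configuration \<Rightarrow> real \<times> real" where
  "torus x = (frac (if x \<in> E then \<rho> x else 0), frac (if x \<in> E then \<sigma> x else 0))"

lemma measurable_torus [measurable]: "torus \<in> measurable configuration_borel (borel \<Otimes>\<^sub>M borel)"
proof -
  have bit [measurable]: "(\<lambda>x. real_of_int (bit x t m k)) \<in> borel_measurable configuration_borel" for t m k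
  proof -
    have "(\<lambda>x. real_of_int (bit x t m k)) = indicator {x. x (pt (15 * m + 3 + 2 * int t) k) = s1}"
      by (auto simp: bit_def fun_eq_iff)
    then show ?thesis by (simp only: borel_measurable_indicator sets_configuration_coordinate)
  qed
  have [measurable]: "(\<lambda>x. if x \<in> E then \<rho> x else 0) \<in> borel_measurable configuration_borel"
    "(\<lambda>x. if x \<in> E then \<sigma> x else 0) \<in> borel_measurable configuration_borel"
    unfolding \<rho>_def \<sigma>_def by (rule measurable_phase; use bit E_phase in blast)+
  show ?thesis unfolding torus_def by measurable
qed

text \<open>One block to the right is one column of the array: the heights of entry 0 are reindexed,
  while entry 1 is the same in all columns.\<close>

lemma torus_shift1:
  assumes "x \<in> E"
  shows "torus (shift (pt 15 0) x) = (frac (fst (torus x) + gold), snd (torus x))"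
proof -
  let ?y = "shift (pt 15 0) x"
  have y: "?y \<in> E" using shift_E[of 1 0 x] assms by simp
  have "(\<lambda>m. bit ?y 0 m 0) = (\<lambda>m. bit x 0 (m + 1) 0)" by (simp add: bit_def algebra_simps)
  then have "\<rho> ?y = \<rho> x + gold - of_int (bit x 0 0 0)"
    unfolding \<rho>_def by (simp only: phase_shift[OF E_phase(3)[OF assms]])
  then have "frac (\<rho> ?y) = frac (\<rho> x + gold)"
    by (simp add: frac_def)
  moreover have "bit ?y 1 0 k = bit x 1 0 k" for k
  proof -
    have "bit ?y 1 0 k = bit x 1 1 k" by (simp add: bit_def algebra_simps)
    then show ?thesis
      using golden_array_heights(2)[OF E_word(4)[OF assms], of 1 k]
        golden_array_heights(2)[OF E_word(4)[OF assms], of 0 k] by simp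
  qed
  then have "(\<lambda>k. bit ?y 1 0 k) = (\<lambda>k. bit x 1 0 k)" by (rule ext)
  then have "\<sigma> ?y = \<sigma> x" unfolding \<sigma>_def by (simp only:)
  ultimately show ?thesis using assms y by (simp add: torus_def frac_add_frac)
qed

lemma torus_shift2:
  assumes "x \<in> E"
  shows "torus (shift (pt 0 1) x) = (fst (torus x), frac (snd (torus x) + gold))"
proof -
  let ?y = "shift (pt 0 1) x"
  have y: "?y \<in> E" using shift_E[of 0 1 x] assms by simp
  have "(\<lambda>k. bit ?y 1 0 k) = (\<lambda>k. bit x 1 0 (k + 1))" by (simp add: bit_def algebra_simps)
  then have "\<sigma> ?y = \<sigma> x + gold - of_int (bit x 1 0 0)"
    unfolding \<sigma>_def by (simp only: phase_shift[OF E_phase(4)[OF assms]])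
  then have "frac (\<sigma> ?y) = frac (\<sigma> x + gold)"
    by (simp add: frac_def)
  moreover have "bit ?y 0 m 0 = bit x 0 m 0" for m
  proof -
    have "bit ?y 0 m 0 = bit x 0 m 1" by (simp add: bit_def algebra_simps)
    then show ?thesis
      using golden_array_heights(1)[OF E_word(4)[OF assms], of m 1]
        golden_array_heights(1)[OF E_word(4)[OF assms], of m 0] by simp
  qed
  then have "(\<lambda>m. bit ?y 0 m 0) = (\<lambda>m. bit x 0 m 0)" by (rule ext)
  then have "\<rho> ?y = \<rho> x" unfolding \<rho>_def by (simp only:)
  ultimately show ?thesis using assms y by (simp add: torus_def frac_add_frac)
qed

text \<open>A phase equal to 1 would have fractional part 0, which genericity excludes; hence
  \<open>frac\<close> leaves both phases unchanged.\<close>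

lemma code_torus:
  assumes "x \<in> E" "gold_generic (torus x)"
  shows "x = code (torus x)"
proof -
  have "\<rho> x \<noteq> 1" "\<sigma> x \<noteq> 1"
  proof -
    have *: "of_int 0 * gold + fst (torus x) \<noteq> of_int 0" "of_int 0 * gold + snd (torus x) \<noteq> of_int 0"
      using assms(2) unfolding gold_generic_def by blast+
    have "frac (1 :: real) = 0" by simp
    with * show "\<rho> x \<noteq> 1" "\<sigma> x \<noteq> 1" using assms(1) by (auto simp: torus_def)
  qed
  then have "torus x = (\<rho> x, \<sigma> x)"
    using E_phase(1,2)[OF assms(1)] assms(1) by (auto simp: torus_def frac_eq)
  then show ?thesis using E_generic[OF assms(1)] assms(2) by simp
qed

text \<open>The values of the invariant measure to be found: uniform phases, and a uniform position
  \<open>z\<close> of the origin within its block.\<close>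

definition mass :: "('d, 'a) configuration set \<Rightarrow> ennreal" where
  "mass S = (\<Sum>z\<in>{0..14}. emeasure (unif \<Otimes>\<^sub>M unif) {t. shift (pt z 0) (code t) \<in> S}) / 15"

section \<open>Uniqueness of the invariant measure\<close>

lemma E_shift_disjoint:
  assumes "y \<in> E" "1 \<le> d" "d \<le> 14"
  shows "shift (pt d 0) y \<notin> E"
proof
  assume "shift (pt d 0) y \<in> E"
  then have s: "y (pt d 0) = s1" "y (pt (d + 1) 0) = s1" by (simp_all add: E_def sync_def)
  \<comment> \<open>One of \<open>d\<close> and \<open>d + 1\<close> is an even position between 2
    and 14 of the block of \<open>y\<close>, where the word has \<open>s0\<close>.\<close>
  obtain j where j: "d = 2 * j \<or> d + 1 = 2 * j" by (meson evenE odd_even_add odd_one)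
  then have "y (pt (15 * 0 + 2 * j) 0) = s0" using assms by (intro E_word(3)) auto
  then show False using j s s01 by auto
qed

text \<open>Almost every configuration has exactly one block beginning among the positions
  \<open>- z\<close> with \<open>z\<close> from 0 to 14; invariance moves it to the origin.\<close>

lemma emeasure_decompose:
  assumes \<mu>: "\<mu> \<in> invariant_measures X" and S: "S \<in> sets configuration_borel"
  shows "emeasure \<mu> S = (\<Sum>z\<in>{0..14}. emeasure \<mu> (E \<inter> shift (pt z 0) -` S))"
proof -
  have sets [measurable_cong]: "sets \<mu> = sets configuration_borel"
    and inv: "\<And>u A. A \<in> sets \<mu> \<Longrightarrow> emeasure \<mu> (shift u -` A) = emeasure \<mu> A"
    and X: "emeasure \<mu> X = 1" and "prob_space \<mu>"
    using \<mu> by (auto simp: invariant_measures_def)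
  interpret \<mu>: prob_space \<mu> by fact
  define F where "F z = shift (pt (- z) 0) -` E" for z
  have F: "F z \<in> sets \<mu>" for z
    using measurable_sets[OF measurable_shift sets_E, of "pt (- z) 0"] by (simp add: F_def sets)
  have SF: "S \<inter> F z \<in> sets \<mu>" for z using S F by (auto simp: sets)
  have "emeasure \<mu> S = emeasure \<mu> (S \<inter> X)"
  proof (rule emeasure_eq_AE)
    have "AE x in \<mu>. x \<in> X"
      using X by (intro \<mu>.AE_in_set_eq_1[THEN iffD2]) (auto simp: sets \<mu>.emeasure_eq_measure)
    then show "AE x in \<mu>. x \<in> S \<longleftrightarrow> x \<in> S \<inter> X" by eventually_elim auto
  qed (use S in \<open>auto simp: sets\<close>)
  also have "S \<inter> X = (\<Union>z\<in>{0..14}. S \<inter> F z)"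
  proof -
    have "(\<exists>z\<in>{0..14}. x \<in> F z)" if "x \<in> X" for x
    proof -
      have "coding_rule (shift 0 x)" using that by (simp only: X_rule)
      then obtain i where "i \<in> {-14..0}" "sync (shift (pt i 0) x)" by (auto simp: coding_rule_def)
      then show ?thesis using that by (intro bexI[of _ "- i"]) (auto simp: F_def E_def)
    qed
    moreover have "x \<in> X" if "x \<in> F z" for x z using that by (auto simp: F_def E_def)
    ultimately show ?thesis by blast
  qed
  also have "emeasure \<mu> \<dots> = (\<Sum>z\<in>{0..14}. emeasure \<mu> (S \<inter> F z))"
  proof (rule sum_emeasure[symmetric])
    have "F z \<inter> F z' = {}" if "z' < z" "z \<le> 14" "0 \<le> z'" for z z'
    proof -
      have "shift (pt (- z') 0) x \<notin> E" if "shift (pt (- z) 0) x \<in> E" for x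
        using E_shift_disjoint[OF that, of "z - z'"] \<open>z' < z\<close> \<open>z \<le> 14\<close> \<open>0 \<le> z'\<close>
        by (simp add: shift_shift pt_add)
      then show ?thesis by (auto simp: F_def)
    qed
    then show "disjoint_family_on (\<lambda>z. S \<inter> F z) {0..14}"
      unfolding disjoint_family_on_def by (auto simp: neq_iff) blast+
  qed (use SF in auto)
  also have "\<dots> = (\<Sum>z\<in>{0..14}. emeasure \<mu> (E \<inter> shift (pt z 0) -` S))"
  proof (rule sum.cong)
    fix z :: int
    have "shift (pt z 0) -` (S \<inter> F z) = E \<inter> shift (pt z 0) -` S"
      by (auto simp: F_def shift_shift pt_add pt_0)
    then show "emeasure \<mu> (S \<inter> F z) = emeasure \<mu> (E \<inter> shift (pt z 0) -` S)"
      using inv[OF SF, of "pt z 0" z] by simp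
  qed simp
  finally show ?thesis .
qed

lemma emeasure_E:
  assumes \<mu>: "\<mu> \<in> invariant_measures X"
  shows "emeasure \<mu> E = 1 / 15"
proof -
  have "prob_space \<mu>" and sets: "sets \<mu> = sets configuration_borel"
    using \<mu> by (auto simp: invariant_measures_def)
  then interpret \<mu>: prob_space \<mu> by simp
  have space: "space \<mu> = UNIV" using sets_eq_imp_space_eq[OF sets] by simp
  have "(UNIV :: ('d, 'a) configuration set) \<in> sets configuration_borel"
    using sets.top[of "configuration_borel :: ('d, 'a) configuration measure"] by simp
  from emeasure_decompose[OF \<mu> this] have "emeasure \<mu> UNIV = 15 * emeasure \<mu> E" by simp
  then have "15 * \<mu>.prob E = 1"
    using \<mu>.prob_space by (simp add: \<mu>.emeasure_eq_measure space ennreal_mult'[symmetric] ennreal_numeral[symmetric] del: ennreal_numeral)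
  then have "\<mu>.prob E = 1 / 15" by simp
  moreover have "ennreal (1 / 15) = ennreal 1 / ennreal 15" by (rule divide_ennreal[symmetric]) simp_all
  ultimately show ?thesis by (simp only: \<mu>.emeasure_eq_measure ennreal_1 ennreal_numeral)
qed

text \<open>Conditioned on \<open>E\<close> and pushed to the torus, \<open>\<mu>\<close> is
  invariant under both rotations, hence Lebesgue. Thus almost every phase pair is generic and
  \<open>x = code (torus x)\<close> almost surely, which turns events in \<open>E\<close> into
  events on the torus.\<close>

lemma emeasure_in_E:
  assumes \<mu>: "\<mu> \<in> invariant_measures X" and S: "S \<in> sets configuration_borel"
  shows "emeasure \<mu> (E \<inter> S) = emeasure (unif \<Otimes>\<^sub>M unif) {t. code t \<in> S} / 15"
proof -
  have sets [measurable_cong]: "sets \<mu> = sets configuration_borel"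
    and inv: "\<And>u A. A \<in> sets \<mu> \<Longrightarrow> emeasure \<mu> (shift u -` A) = emeasure \<mu> A"
    and "prob_space \<mu>"
    using \<mu> by (auto simp: invariant_measures_def)
  interpret \<mu>: prob_space \<mu> by fact
  have space: "space \<mu> = UNIV" using sets_eq_imp_space_eq[OF sets] by simp
  note S [measurable]
  define \<nu> where "\<nu> = uniform_measure \<mu> E"
  have E: "emeasure \<mu> E = 1 / 15" by (rule emeasure_E[OF \<mu>])
  have E_ne: "emeasure \<mu> E \<noteq> 0" "emeasure \<mu> E \<noteq> \<infinity>" by (simp_all add: E divide_ennreal_def)
  interpret \<nu>: prob_space \<nu> unfolding \<nu>_def by (rule prob_space_uniform_measure[OF E_ne])
  have sets_\<nu> [measurable_cong]: "sets \<nu> = sets configuration_borel" by (simp add: \<nu>_def sets)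
  have space_\<nu>: "space \<nu> = UNIV" by (simp add: \<nu>_def space)
  have em: "emeasure \<nu> A = emeasure \<mu> (E \<inter> A) / (1 / 15)" if "A \<in> sets configuration_borel" for A
    using that by (simp add: \<nu>_def sets E)
  define N where "N = distr \<nu> (borel \<Otimes>\<^sub>M borel) torus"
  have emN: "emeasure N A = emeasure \<mu> (E \<inter> torus -` A) / (1 / 15)" if [measurable]: "A \<in> sets (borel \<Otimes>\<^sub>M borel)" for A
  proof -
    have "torus -` A \<in> sets configuration_borel"
      using measurable_sets[OF measurable_torus that] by simp
    then show ?thesis by (simp add: N_def emeasure_distr space_\<nu> em)
  qed
  \<comment> \<open>Moves by whole blocks and rows preserve \<open>E\<close>, so the invariance of
    \<open>\<mu>\<close> passes to the part inside \<open>E\<close>.\<close>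
  have shift_eq: "emeasure \<mu> (E \<inter> torus -` A) = emeasure \<mu> (E \<inter> torus -` B)"
    if B [measurable]: "B \<in> sets (borel \<Otimes>\<^sub>M borel)"
      and AB: "\<And>x. x \<in> E \<Longrightarrow> torus x \<in> A \<longleftrightarrow> torus (shift (pt (15 * m) k) x) \<in> B" for A B m k
  proof -
    have "E \<inter> torus -` B \<in> sets \<mu>"
      using measurable_sets[OF measurable_torus B] by (simp add: sets sets.Int[OF sets_E])
    moreover have "shift (pt (15 * m) k) -` (E \<inter> torus -` B) = E \<inter> torus -` A"
      by (intro set_eqI) (simp add: AB cong: conj_cong)
    ultimately show ?thesis using inv by metis
  qed
  have N_eq: "N = unif \<Otimes>\<^sub>M unif"
  proof (rule torus_rotation_invariant)
    show "prob_space N" unfolding N_def by (rule \<nu>.prob_space_distr) measurable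
    show "sets N = sets (borel \<Otimes>\<^sub>M borel)" by (simp add: N_def)
    have "{t \<in> space (borel \<Otimes>\<^sub>M borel). fst t \<in> {0..<1::real} \<and> snd t \<in> {0..<1::real}} \<in> sets (borel \<Otimes>\<^sub>M borel)"
      by measurable
    then show "AE t in N. fst t \<in> {0..<1} \<and> snd t \<in> {0..<1}"
      unfolding N_def by (subst AE_distr_iff) (auto simp: torus_def frac_lt_1)
    fix A B :: "real set" assume AB [measurable]: "A \<in> sets borel" "B \<in> sets borel"
    have AB': "A \<times> B \<in> sets (borel \<Otimes>\<^sub>M borel)" by measurable
    have "emeasure \<mu> (E \<inter> torus -` ({x. frac (x + gold) \<in> A} \<times> B)) = emeasure \<mu> (E \<inter> torus -` (A \<times> B))"
      by (rule shift_eq[OF AB', of _ 1 0]) (simp add: torus_shift1 mem_Times_iff)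
    then show "emeasure N ({x. frac (x + gold) \<in> A} \<times> B) = emeasure N (A \<times> B)" by (simp add: emN)
    have "emeasure \<mu> (E \<inter> torus -` (A \<times> {x. frac (x + gold) \<in> B})) = emeasure \<mu> (E \<inter> torus -` (A \<times> B))"
      by (rule shift_eq[OF AB', of _ 0 1]) (simp add: torus_shift2 mem_Times_iff)
    then show "emeasure N (A \<times> {x. frac (x + gold) \<in> B}) = emeasure N (A \<times> B)" by (simp add: emN)
  qed
  have "AE x in \<nu>. x \<in> E" unfolding \<nu>_def by (rule AE_uniform_measureI) (simp_all add: sets)
  moreover have "AE x in \<nu>. gold_generic (torus x)"
  proof (rule AE_distrD[where M'="borel \<Otimes>\<^sub>M borel"])
    show "AE t in distr \<nu> (borel \<Otimes>\<^sub>M borel) torus. gold_generic t"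
      using AE_gold_generic by (simp only: N_eq flip: N_def)
  qed measurable
  ultimately have ae: "AE x in \<nu>. x = code (torus x)"
    by eventually_elim (rule code_torus)
  have code_S: "{t. code t \<in> S} \<in> sets (borel \<Otimes>\<^sub>M borel)"
    using measurable_sets[OF measurable_code S] by (simp add: space_pair_measure vimage_def)
  have "emeasure \<nu> S = emeasure \<nu> (torus -` {t. code t \<in> S})"
  proof (rule emeasure_eq_AE)
    show "AE x in \<nu>. x \<in> S \<longleftrightarrow> x \<in> torus -` {t. code t \<in> S}"
      using ae by eventually_elim simp
    show "torus -` {t. code t \<in> S} \<in> sets \<nu>"
      using measurable_sets[OF measurable_torus code_S] by (simp add: sets_\<nu>)
  qed (simp add: sets_\<nu> S)
  also have "\<dots> = emeasure N {t. code t \<in> S}"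
    using code_S by (simp add: N_def emeasure_distr space_\<nu>)
  finally have "emeasure \<mu> (E \<inter> S) / (1 / 15) = emeasure (unif \<Otimes>\<^sub>M unif) {t. code t \<in> S}"
    using em[OF S] N_eq by simp
  moreover have "a = b / 15" if "a / (1 / 15) = b" for a b :: ennreal
  proof -
    have "1 / 15 = ennreal (1 / 15)" using divide_ennreal[of 1 15] by simp
    then have "inverse (1 / 15) = (15 :: ennreal)" by (simp add: inverse_ennreal)
    then have "b = a * 15" using that by (simp add: divide_ennreal_def)
    then show ?thesis by (simp add: ennreal_mult_divide_eq)
  qed
  ultimately show ?thesis by blast
qed

lemma emeasure_mass:
  assumes \<mu>: "\<mu> \<in> invariant_measures X" and S: "S \<in> sets configuration_borel"
  shows "emeasure \<mu> S = mass S"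
proof -
  have "shift u -` S \<in> sets configuration_borel" for u
    using measurable_sets[OF measurable_shift S, of u] by simp
  then show ?thesis
    unfolding emeasure_decompose[OF assms] mass_def
    by (simp add: emeasure_in_E[OF \<mu>] divide_ennreal_def sum_distrib_right)
qed

section \<open>Existence of the invariant measure\<close>

lemma measurable_shift_code [measurable]:
  "(\<lambda>t. shift u (code t)) \<in> measurable (unif \<Otimes>\<^sub>M unif) configuration_borel"
  by measurable

text \<open>A shift permutes the fifteen positions in a block cyclically and rotates the torus, by
  the number \<open>n\<close> of blocks crossed and by the number of rows; the torus measure is
  invariant.\<close>

lemma mass_shift:
  assumes S [measurable]: "S \<in> sets configuration_borel"
  shows "mass (shift u -` S) = mass S"
proof -
  define T where "T z = emeasure (unif \<Otimes>\<^sub>M unif) {t. shift (pt z 0) (code t) \<in> S}" for z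
  have "emeasure (unif \<Otimes>\<^sub>M unif) {t. shift (pt z 0) (code t) \<in> shift u -` S} = T ((z + u $ i1) mod 15)" for z
  proof -
    define n where "n = (z + u $ i1) div 15"
    define rot where "rot = (\<lambda>(p, q). (frac (p + of_int n * gold), frac (q + of_int (u $ i2) * gold)))"
    have "shift u (shift (pt z 0) (code t)) = shift (pt ((z + u $ i1) mod 15) 0) (code (rot t))" for t
    proof -
      obtain p q where t: "t = (p, q)" by force
      show ?thesis
        using code_shift[of "pt z 0 + u" p q n]
        by (simp add: t rot_def code_frac shift_shift n_def minus_mult_div_eq_mod)
    qed
    then have "{t. shift (pt z 0) (code t) \<in> shift u -` S} = rot -` {t. shift (pt ((z + u $ i1) mod 15) 0) (code t) \<in> S}"
      by auto
    moreover have "{t. shift (pt ((z + u $ i1) mod 15) 0) (code t) \<in> S} \<in> sets (borel \<Otimes>\<^sub>M borel)"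
      using measurable_sets[OF measurable_shift_code S] by (simp add: space_pair_measure vimage_def cong: sets_pair_measure_cong)
    moreover have "rot \<in> measurable (unif \<Otimes>\<^sub>M unif) (borel \<Otimes>\<^sub>M borel)"
      unfolding rot_def by measurable
    ultimately show ?thesis
      unfolding T_def by (subst distr_unif2_rotation[of "of_int n * gold" "of_int (u $ i2) * gold", symmetric])
        (simp add: emeasure_distr rot_def[symmetric] space_pair_measure)
  qed
  moreover have "(\<Sum>z\<in>{0..14}. T ((z + u $ i1) mod 15)) = (\<Sum>z\<in>{0..14}. T z)"
  proof (rule sum.reindex_bij_betw)
    show "bij_betw (\<lambda>z. (z + u $ i1) mod 15) {0..14} {0..14}"
    proof (rule bij_betw_byWitness[where f'="\<lambda>z. (z - u $ i1) mod 15"])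
      show "\<forall>z\<in>{0..14}. ((z + u $ i1) mod 15 - u $ i1) mod 15 = z"
        "\<forall>z\<in>{0..14}. ((z - u $ i1) mod 15 + u $ i1) mod 15 = z"
        by (auto simp: mod_diff_left_eq mod_add_left_eq)
      show "(\<lambda>z. (z + u $ i1) mod 15) ` {0..14} \<subseteq> {0..14}" "(\<lambda>z. (z - u $ i1) mod 15) ` {0..14} \<subseteq> {0..14}"
        using pos_mod_bound[of 15] by (auto simp: zle_diff1_eq[symmetric])
    qed
  qed
  ultimately show ?thesis by (simp add: mass_def T_def)
qed

text \<open>An image measure is used so that countable additivity of \<open>mass\<close> comes for
  free.\<close>

definition coded_measure :: "('d, 'a) configuration measure" where
  "coded_measure = distr (measure_pmf (pmf_of_set {0..14}) \<Otimes>\<^sub>M (unif \<Otimes>\<^sub>M unif)) configuration_borel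
     (\<lambda>(z, t). shift (pt z 0) (code t))"

lemma measurable_coded: "(\<lambda>(z, t). shift (pt z 0) (code t)) \<in>
  measurable (measure_pmf (pmf_of_set {0..14}) \<Otimes>\<^sub>M (unif \<Otimes>\<^sub>M unif)) configuration_borel"
proof -
  have "(\<lambda>(z, t). shift (pt z 0) (code t)) \<in>
      measurable (count_space UNIV \<Otimes>\<^sub>M (unif \<Otimes>\<^sub>M unif)) configuration_borel"
    by (rule measurable_pair_measure_countable1) (auto simp: measurable_shift_code)
  then show ?thesis by (simp cong: measurable_cong_sets sets_pair_measure_cong)
qed

lemma emeasure_coded_measure:
  assumes S: "S \<in> sets configuration_borel"
  shows "emeasure coded_measure S = mass S"
proof -
  let ?M = "measure_pmf (pmf_of_set {0..14::int}) \<Otimes>\<^sub>M (unif \<Otimes>\<^sub>M unif)"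
  let ?Q = "(\<lambda>(z, t). shift (pt z 0) (code t)) -` S \<inter> space ?M"
  have "emeasure coded_measure S = emeasure ?M ?Q"
    unfolding coded_measure_def by (rule emeasure_distr[OF measurable_coded S])
  also have "\<dots> = (\<integral>\<^sup>+z. emeasure (unif \<Otimes>\<^sub>M unif) (Pair z -` ?Q) \<partial>measure_pmf (pmf_of_set {0..14}))"
    by (intro unif2.emeasure_pair_measure_alt measurable_sets[OF measurable_coded S])
  also have "\<dots> = (\<Sum>z\<in>{0..14}. emeasure (unif \<Otimes>\<^sub>M unif) (Pair z -` ?Q)) / 15"
    by (subst nn_integral_pmf_of_set) auto
  also have "\<dots> = mass S"
    by (simp add: mass_def space_pair_measure vimage_def)
  finally show ?thesis .
qed

lemma coded_measure_invariant: "coded_measure \<in> invariant_measures X"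
proof -
  interpret U: pair_prob_space "measure_pmf (pmf_of_set {0..14::int})" "unif \<Otimes>\<^sub>M unif"
    by (intro pair_prob_space.intro pair_sigma_finite.intro prob_space_imp_sigma_finite measure_pmf.prob_space_axioms unif2.prob_space_axioms)
  have sets: "sets coded_measure = sets configuration_borel" by (simp add: coded_measure_def)
  have "prob_space coded_measure"
    unfolding coded_measure_def by (rule U.prob_space_distr[OF measurable_coded])
  moreover have "emeasure coded_measure (shift u -` A) = emeasure coded_measure A" if "A \<in> sets coded_measure" for u A
  proof -
    have A: "A \<in> sets configuration_borel" using that by (simp add: sets)
    then have "shift u -` A \<in> sets configuration_borel"
      using measurable_sets[OF measurable_shift A, of u] by simp
    then show ?thesis using A by (simp add: emeasure_coded_measure mass_shift)
  qed
  moreover have "emeasure coded_measure X = 1"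
  proof -
    have "{t. shift (pt z 0) (code t) \<in> X} = UNIV" for z by (simp only: code_in_X UNIV_def)
    then show ?thesis
      by (simp add: emeasure_coded_measure sets_X mass_def emeasure_unif2_UNIV ennreal_divide_self del: shift_X)
  qed
  ultimately show ?thesis by (simp add: invariant_measures_def sets)
qed

lemma uniquely_ergodic_X: "uniquely_ergodic X"
proof -
  have "\<mu> = coded_measure" if "\<mu> \<in> invariant_measures X" for \<mu>
  proof (rule measure_eqI)
    show sets: "sets \<mu> = sets coded_measure"
      using that coded_measure_invariant by (simp add: invariant_measures_def)
    show "emeasure \<mu> A = emeasure coded_measure A" if "A \<in> sets \<mu>" for A
      using that sets emeasure_mass[OF \<open>\<mu> \<in> _\<close>, of A] emeasure_coded_measure[of A]
      by (simp add: coded_measure_def)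
  qed
  then show ?thesis unfolding uniquely_ergodic_def using coded_measure_invariant by blast
qed

section \<open>The two cylinder sets and their frequencies\<close>

lemma cylinder_set_ones: "finite V \<Longrightarrow> cylinder_set {x. \<forall>v\<in>V. x v = s1}"
proof -
  assume V: "finite V"
  have "{x. \<forall>v\<in>V. x v = s1} = cylinder V (restrict (\<lambda>_. s1) V)"
    by (auto simp: cylinder_def fun_eq_iff restrict_def)
  then show ?thesis unfolding cylinder_set_def using V
    by (intro exI[of _ V] exI[of _ "restrict (\<lambda>_. s1) V"]) auto
qed

lemma sets_ones: "finite V \<Longrightarrow> {x. \<forall>v\<in>V. x v = s1} \<in> sets configuration_borel"
  using sets.sets_Collect_finite_All[of V configuration_borel "\<lambda>v x. x v = s1"]
  by (simp add: sets_configuration_coordinate)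

text \<open>By \<open>code_sync\<close> only the position \<open>z = 0\<close> can
  contribute.\<close>

lemma mass_sync:
  assumes "\<And>x. x \<in> S \<Longrightarrow> sync x"
  shows "mass S = emeasure (unif \<Otimes>\<^sub>M unif) {t. code t \<in> S} / 15"
proof -
  have "emeasure (unif \<Otimes>\<^sub>M unif) {t. shift (pt z 0) (code t) \<in> S} = 0" if "z \<in> {0..14} - {0}" for z
  proof -
    have "z mod 15 \<noteq> 0" using that by simp
    then have "{t. shift (pt z 0) (code t) \<in> S} = {}"
      using assms code_sync[of "pt z 0"] by auto
    then show ?thesis by (simp only: emeasure_empty)
  qed
  then have "(\<Sum>z\<in>{0..14}. emeasure (unif \<Otimes>\<^sub>M unif) {t. shift (pt z 0) (code t) \<in> S}) =
      emeasure (unif \<Otimes>\<^sub>M unif) {t. code t \<in> S}"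
    by (subst sum.remove[of _ 0]) (auto simp: pt_0)
  then show ?thesis by (simp add: mass_def)
qed

text \<open>For \<open>p\<close> in the unit interval the floor increases exactly on the arc from
  \<open>1 - gold\<close> to 1, which has length \<open>gold\<close>.\<close>

lemma emeasure_state_0: "emeasure (unif \<Otimes>\<^sub>M unif) {t. state 0 (fst t) (snd t) = 1} = ennreal gold"
proof -
  have "{t. state 0 (fst t) (snd t) = 1} = {p. \<lfloor>p + gold\<rfloor> - \<lfloor>p\<rfloor> = 1} \<times> UNIV"
    by (auto simp: state_def)
  moreover have m: "{p::real. \<lfloor>p + gold\<rfloor> - \<lfloor>p\<rfloor> = 1} \<in> sets borel"
    by measurable
  ultimately have "emeasure (unif \<Otimes>\<^sub>M unif) {t. state 0 (fst t) (snd t) = 1} = emeasure unif {p. \<lfloor>p + gold\<rfloor> - \<lfloor>p\<rfloor> = 1}"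
    using unif.emeasure_space_1 by (simp add: unif.emeasure_pair_measure_Times)
  also have "\<dots> = emeasure lborel {1 - gold..<1}"
  proof -
    have "{0..<1} \<inter> {p. \<lfloor>p + gold\<rfloor> - \<lfloor>p\<rfloor> = 1} = {1 - gold..<1}"
    proof (intro set_eqI iffI)
      fix p assume "p \<in> {1 - gold..<1}"
      then show "p \<in> {0..<1} \<inter> {p. \<lfloor>p + gold\<rfloor> - \<lfloor>p\<rfloor> = 1}"
        using gold_less_1 gold_pos floor_unique[of 0 p] floor_unique[of 1 "p + gold"] by auto
    next
      fix p assume "p \<in> {0..<1} \<inter> {p. \<lfloor>p + gold\<rfloor> - \<lfloor>p\<rfloor> = 1}"
      then have p: "0 \<le> p" "p < 1" "\<lfloor>p + gold\<rfloor> - \<lfloor>p\<rfloor> = 1" by auto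
      then have "\<lfloor>p\<rfloor> = 0" by (intro floor_unique) simp_all
      with p have "\<lfloor>p + gold\<rfloor> = 1" by simp
      with p show "p \<in> {1 - gold..<1}" by (simp add: floor_eq_iff)
    qed
    then show ?thesis by (simp add: emeasure_unif[OF m])
  qed
  finally show ?thesis using gold_pos by simp
qed

lemma irrational_ratio:
  "\<exists>(X :: ('d, 'a) configuration set) \<mu> C C'.
    shift_of_finite_type X \<and> uniquely_ergodic X \<and> \<mu> \<in> invariant_measures X \<and>
    cylinder_set C \<and> cylinder_set C' \<and>
    measure \<mu> C' > 0 \<and> measure \<mu> C / measure \<mu> C' \<notin> \<rat>"
proof -
  \<comment> \<open>\<open>C'\<close> says that a block begins at the origin. \<open>C\<close> adds
    that \<open>b\<^sub>0\<close>, at position 3 of the word, is one.\<close>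
  define C' where "C' = {x :: ('d, 'a) configuration. \<forall>v\<in>{pt 0 0, pt 1 0}. x v = s1}"
  define C where "C = {x :: ('d, 'a) configuration. \<forall>v\<in>{pt 0 0, pt 1 0, pt 3 0}. x v = s1}"
  have code_C': "{t. code t \<in> C'} = UNIV"
    using code_sync[of 0] by (auto simp: C'_def sync_def)
  have "code t \<in> C \<longleftrightarrow> state 0 (fst t) (snd t) = 1" for t
  proof -
    have "sync (code t)" using code_sync[of 0 t] by simp
    moreover have "code t (pt 3 0) = s1 \<longleftrightarrow> state 0 (fst t) (snd t) = 1"
      using s01 by (simp add: code_def)
    ultimately show ?thesis by (auto simp: C_def sync_def)
  qed
  then have code_C: "{t. code t \<in> C} = {t. state 0 (fst t) (snd t) = 1}" by simp
  have "emeasure coded_measure C' = mass C'" "emeasure coded_measure C = mass C"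
    unfolding C'_def C_def by (intro emeasure_coded_measure sets_ones; simp)+
  moreover have "mass C' = emeasure (unif \<Otimes>\<^sub>M unif) {t. code t \<in> C'} / 15"
    "mass C = emeasure (unif \<Otimes>\<^sub>M unif) {t. code t \<in> C} / 15"
    by (rule mass_sync; simp add: C_def C'_def sync_def)+
  moreover have q: "ennreal a / 15 = ennreal (a / 15)" if "0 \<le> a" for a
    using divide_ennreal[OF that, of 15] by simp
  ultimately have m: "measure coded_measure C' = 1 / 15" "measure coded_measure C = gold / 15"
    using gold_pos q[of 1] q[of gold]
    by (simp_all add: measure_def code_C code_C' emeasure_state_0 emeasure_unif2_UNIV)
  have "measure coded_measure C' > 0 \<and> measure coded_measure C / measure coded_measure C' \<notin> \<rat>"
    unfolding m using gold_irrational by simp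
  moreover have "cylinder_set C" "cylinder_set C'"
    unfolding C_def C'_def by (rule cylinder_set_ones; simp)+
  ultimately show ?thesis
    using sft_X uniquely_ergodic_X coded_measure_invariant by blast
qed

end

theorem theorem6:
  assumes "CARD('a::finite) \<ge> 2" and "CARD('d::finite) \<ge> 2"
  shows "\<exists>(X :: ('d, 'a) configuration set) \<mu> C C'.
    shift_of_finite_type X \<and> uniquely_ergodic X \<and> \<mu> \<in> invariant_measures X \<and>
    cylinder_set C \<and> cylinder_set C' \<and>
    measure \<mu> C' > 0 \<and> measure \<mu> C / measure \<mu> C' \<notin> \<rat>"
proof -
  obtain s0 s1 :: 'a where "s0 \<noteq> s1"
    using assms(1) card_le_Suc0_iff_eq[of "UNIV :: 'a set"] by (auto simp: numeral_2_eq_2 not_less_eq_eq[symmetric])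
  moreover obtain i1 i2 :: 'd where "i1 \<noteq> i2"
    using assms(2) card_le_Suc0_iff_eq[of "UNIV :: 'd set"] by (auto simp: numeral_2_eq_2 not_less_eq_eq[symmetric])
  ultimately interpret binary_coding i1 i2 s0 s1 by unfold_locales
  show ?thesis by (rule irrational_ratio)
qed

end
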